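(* Let $a \in \mathbb{R}^d$ with $a\neq 0$, $\Sigma_X,\Sigma_Y$ be positive definite $d\times d$ matrices, and $\mathcal{L}_1,\mathcal{L}_2$ be cdfs on $\mathbb{R}$, all known. For unknown $\theta\in\mathbb{R}^d$, let $X|\theta \sim MMN_d(\theta, a, \Sigma_X, \mathcal{L}_1)$ and $Y|\theta \sim MMN_d(\theta, a, \Sigma_Y, \mathcal{L}_2)$ be independently distributed, i.e., $X|\theta,V_1 \sim N_d(\theta+V_1 a,\Sigma_X)$ and $Y|\theta,V_2\sim N_d(\theta+V_2 a,\Sigma_Y)$ with $V_1\sim\mathcal{L}_1$ and $V_2\sim\mathcal{L}_2$ independent. Then the minimum risk equivariant (MRE) predictive density estimator of the density of $Y$ based on $X$ under Kullback-Leibler loss is given by the Bayes predictive density $\hat{q}_U$ under the prior $\pi_U(\theta)=1$. Furthermore, $$ \hat{q}_U(\cdot;X) \sim MMN_d(X, a, \Sigma_X+\Sigma_Y, \mathcal{L}_3), $$ where $\mathcal{L}_3$ is the cdf of $V_3 = V_2 - V_1$. Finally, $\hat{q}_U(y;X)$ is minimax under Kullback-Leibler loss.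
   Context: A random vector $X \in \mathbb{R}^d$ has a mean-mixture of normal distributions, written $X \sim MMN_d(\theta, a, \Sigma, \mathcal{L})$, if $X|V=v \sim N_d(\theta + v a, \Sigma)$ with $V \sim \mathcal{L}$, where $\theta\in\mathbb{R}^d$ is a location parameter, $a \in \mathbb{R}^d$ a perturbation vector, $\Sigma$ a positive definite matrix, and $V$ a scalar random variable with cdf $\mathcal{L}$. With $p(\cdot|\theta)$ and $q(\cdot|\theta)$ the densities of $X$ and $Y$ given $\theta$, the Kullback-Leibler risk of a predictive density estimator $\hat{q}(\cdot;X)$ is $R_{KL}(\theta,\hat{q}) = \int_{\mathbb{R}^d} \left\{ \int_{\mathbb{R}^d} q(y|\theta) \log \frac{q(y|\theta)}{\hat{q}(y;x)}\, dy \right\} p(x|\theta)\, dx$. The Bayes predictive density for the prior $\pi_U(\theta)=1$ (Lebesgue measure on $\mathbb{R}^d$) is $\hat{q}_U(y;x) = \int_{\mathbb{R}^d} q(y|\theta)\,p(x|\theta)\,d\theta \big/ \int_{\mathbb{R}^d} p(x|\theta)\,d\theta$. A predictive density estimator is equivariant under changes of location if $\hat{q}(y+c;x+c)=\hat{q}(y;x)$ for all $x,y,c\in\mathbb{R}^d$; equivariant estimators have constant risk in $\theta$, and the MRE estimator minimizes this risk among equivariant estimators. A predictive density estimator is minimax if it minimizes $\sup_{\theta} R_{KL}(\theta,\cdot)$ among all predictive density estimators. *)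

theory Defs
  imports "HOL-Probability.Probability"
begin

definition pos_def :: "real^'d^'d \<Rightarrow> bool" where
  "pos_def S \<longleftrightarrow> transpose S = S \<and> (\<forall>x. x \<noteq> 0 \<longrightarrow> x \<bullet> (S *v x) > 0)"

definition mvn_density :: "real^'d \<Rightarrow> real^'d^'d \<Rightarrow> real^'d \<Rightarrow> real" where
  "mvn_density \<mu> S x =
     exp (- ((x - \<mu>) \<bullet> (matrix_inv S *v (x - \<mu>))) / 2) / sqrt ((2 * pi) ^ CARD('d) * det S)"

definition mvn :: "real^'d \<Rightarrow> real^'d^'d \<Rightarrow> (real^'d) measure" where
  "mvn \<mu> S = density lborel (\<lambda>x. ennreal (mvn_density \<mu> S x))"

(* On the probability space M, the random variable V has cdf L, and the kernel
   v \<mapsto> N(\<theta> + v a, S) is a regular conditional distribution of X given V. *)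
definition mean_mixture_normal ::
  "'w measure \<Rightarrow> ('w \<Rightarrow> real) \<Rightarrow> ('w \<Rightarrow> real^'d)
     \<Rightarrow> real^'d \<Rightarrow> real^'d \<Rightarrow> real^'d^'d \<Rightarrow> (real \<Rightarrow> real) \<Rightarrow> bool" where
  "mean_mixture_normal M V X \<theta> a S L \<longleftrightarrow>
     prob_space M \<and> pos_def S \<and>
     V \<in> borel_measurable M \<and> X \<in> borel_measurable M \<and>
     cdf (distr M borel V) = L \<and>
     (\<forall>A \<in> sets borel. \<forall>B \<in> sets borel.
        emeasure M {\<omega> \<in> space M. V \<omega> \<in> A \<and> X \<omega> \<in> B} =
        (\<integral>\<^sup>+ v \<in> A. emeasure (mvn (\<theta> + v *\<^sub>R a) S) B \<partial>(distr M borel V)))"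

(* The law P is MMN(\<theta>, a, S, L): it is the law of some X admitting a mixing variable V as above.
   Such a pair (V, X) may be taken to be the coordinates of a law J on the product space. *)
definition MMN_law ::
  "(real^'d) measure \<Rightarrow> real^'d \<Rightarrow> real^'d \<Rightarrow> real^'d^'d \<Rightarrow> (real \<Rightarrow> real) \<Rightarrow> bool" where
  "MMN_law P \<theta> a S L \<longleftrightarrow>
     (\<exists>J :: (real \<times> (real^'d)) measure.
        mean_mixture_normal J fst snd \<theta> a S L \<and> distr J borel snd = P)"

(* A jointly measurable function of (y, x) that is, for every x, a Lebesgue density in y;
   r y x is the estimated density at y when x is observed. *)
definition pred_density :: "(real^'d \<Rightarrow> real^'d \<Rightarrow> real) \<Rightarrow> bool" where
  "pred_density r \<longleftrightarrow>
     (\<lambda>(y, x). r y x) \<in> borel_measurable (borel \<Otimes>\<^sub>M borel) \<and>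
     (\<forall>y x. 0 \<le> r y x) \<and>
     (\<forall>x. (\<integral>\<^sup>+ y. ennreal (r y x) \<partial>lborel) = 1)"

definition equivariant :: "(real^'d \<Rightarrow> real^'d \<Rightarrow> real) \<Rightarrow> bool" where
  "equivariant r \<longleftrightarrow> (\<forall>x y c. r (y + c) (x + c) = r y x)"

(* Integral of an extended-real function as positive part minus negative part (e2ennreal
   truncates at 0). In the risk below the negative part always has a finite integral, so the
   difference is never \<infinity> - \<infinity>. The Bochner integral would return 0 when the divergence is infinite. *)
definition ext_integral :: "'a measure \<Rightarrow> ('a \<Rightarrow> ereal) \<Rightarrow> ereal" where
  "ext_integral M f =
     enn2ereal (\<integral>\<^sup>+ x. e2ennreal (f x) \<partial>M) - enn2ereal (\<integral>\<^sup>+ x. e2ennreal (- f x) \<partial>M)"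

(* s log (s / t) with the conventions 0 log (0 / t) = 0 and s log (s / 0) = \<infinity> for s > 0. *)
definition kl_term :: "real \<Rightarrow> real \<Rightarrow> ereal" where
  "kl_term s t = (if s = 0 then 0 else if t = 0 then \<infinity> else ereal (s * ln (s / t)))"

definition KL_risk ::
  "(real^'d \<Rightarrow> real^'d \<Rightarrow> real) \<Rightarrow> (real^'d \<Rightarrow> real^'d \<Rightarrow> real)
     \<Rightarrow> real^'d \<Rightarrow> (real^'d \<Rightarrow> real^'d \<Rightarrow> real) \<Rightarrow> ereal" where
  "KL_risk p q \<theta> r =
     ext_integral lborel (\<lambda>x. ext_integral lborel (\<lambda>y. kl_term (q \<theta> y) (r y x)) * ereal (p \<theta> x))"

definition bayes_uniform ::
  "(real^'d \<Rightarrow> real^'d \<Rightarrow> real) \<Rightarrow> (real^'d \<Rightarrow> real^'d \<Rightarrow> real) \<Rightarrow> real^'d \<Rightarrow> real^'d \<Rightarrow> real" where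
  "bayes_uniform p q y x =
     (\<integral> \<theta>. q \<theta> y * p \<theta> x \<partial>lborel) / (\<integral> \<theta>. p \<theta> x \<partial>lborel)"

(* Comparing at every \<theta> avoids choosing a representative of the (constant) risk
   of an equivariant estimator. *)
definition is_MRE ::
  "(real^'d \<Rightarrow> real^'d \<Rightarrow> real) \<Rightarrow> (real^'d \<Rightarrow> real^'d \<Rightarrow> real)
     \<Rightarrow> (real^'d \<Rightarrow> real^'d \<Rightarrow> real) \<Rightarrow> bool" where
  "is_MRE p q r \<longleftrightarrow>
     pred_density r \<and> equivariant r \<and>
     (\<forall>r'. pred_density r' \<and> equivariant r' \<longrightarrow> (\<forall>\<theta>. KL_risk p q \<theta> r \<le> KL_risk p q \<theta> r'))"

definition is_minimax ::
  "(real^'d \<Rightarrow> real^'d \<Rightarrow> real) \<Rightarrow> (real^'d \<Rightarrow> real^'d \<Rightarrow> real)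
     \<Rightarrow> (real^'d \<Rightarrow> real^'d \<Rightarrow> real) \<Rightarrow> bool" where
  "is_minimax p q r \<longleftrightarrow>
     pred_density r \<and>
     (\<forall>r'. pred_density r' \<longrightarrow> (SUP \<theta>. KL_risk p q \<theta> r) \<le> (SUP \<theta>. KL_risk p q \<theta> r'))"

(* The continuous version of the density of Z on M. A mean mixture of normals has exactly one;
   fixing it makes p(x | \<theta>) well defined as a function of \<theta> for each single x. *)
definition continuous_density :: "'w measure \<Rightarrow> ('w \<Rightarrow> real^'d) \<Rightarrow> (real^'d \<Rightarrow> real) \<Rightarrow> bool" where
  "continuous_density M Z f \<longleftrightarrow>
     continuous_on UNIV f \<and> (\<forall>z. 0 \<le> f z) \<and> distributed M lborel Z (\<lambda>z. ennreal (f z))"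

end

theory Submission
  imports Defs
begin

text \<open>
  Both observations have location densities, \<open>p \<theta> x = f\<^sub>1 (x - \<theta>)\<close> and \<open>q \<theta> y = f\<^sub>2 (y - \<theta>)\<close>, where \<open>f\<^sub>1\<close>
  and \<open>f\<^sub>2\<close> are the mixture densities; two continuous functions that agree almost everywhere are equal,
  so this holds at every point (\<open>mean_mixture_normal_density_unique\<close>). Under the uniform prior the Bayes
  predictive density is therefore \<open>g (y - x)\<close>, where \<open>g w = \<integral> f\<^sub>2 (w + u) f\<^sub>1 u du\<close> is the density of
  \<open>Y - X\<close>. That \<open>g\<close> is again a mean mixture of normals, now mixed over \<open>V\<^sub>2 - V\<^sub>1\<close>, is Fubini together
  with the convolution formula for two normal densities (\<open>diff_density_mixture_density\<close>,
  \<open>mvn_density_convolution\<close>).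

  For densities \<open>s\<close> and \<open>t\<close> the divergence \<open>\<integral> s ln (s/t)\<close> equals the integral of the nonnegative
  function \<open>s ln (s/t) + t - s\<close>, so all risks become Lebesgue integrals of nonnegative functions. Infinite
  risks then need no separate treatment. Both optimality claims rest on one fact: averaged
  over \<open>s\<close>, this excess is minimised in \<open>t\<close> by the mean of \<open>s\<close> (\<open>kl_excess_mean_le\<close>).

  An equivariant estimator has the form \<open>h (y - x)\<close>. Its risk is an integral over \<open>w\<close> of the average over
  \<open>u\<close>, with weight \<open>f\<^sub>1 u\<close>, of the excess of \<open>f\<^sub>2 (w + u)\<close> over \<open>h w\<close>; for each \<open>w\<close> the mean \<open>g w\<close> is the
  best choice. This gives the minimum risk equivariant part.

  For minimaxity, the supremum of the risk of any estimator is at least its average risk when \<open>\<theta> = c \<tau>\<close>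
  and \<open>\<tau>\<close> has a fixed continuous positive bounded density. This average is at least the one of the
  posterior mean for that prior. In coordinates centred at \<open>\<theta>\<close>, the posterior mean converges pointwise to
  \<open>g (y - x)\<close> as \<open>c\<close> tends to infinity, because the prior becomes flat. Fatou's lemma then bounds the
  supremum from below by the constant risk of \<open>g (y - x)\<close>.
\<close>

section \<open>Linear changes of variables and the multivariate Gaussian integral\<close>

lemma nn_integral_lborel_translate:
  fixes f :: "'a::euclidean_space \<Rightarrow> ennreal"
  assumes [measurable]: "f \<in> borel_measurable borel"
  shows "(\<integral>\<^sup>+x. f (c + x) \<partial>lborel) = (\<integral>\<^sup>+x. f x \<partial>lborel)"
proof -
  have "(\<integral>\<^sup>+x. f x \<partial>distr lborel borel ((+) c)) = (\<integral>\<^sup>+x. f (c + x) \<partial>lborel)"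
    by (rule nn_integral_distr) auto
  then show ?thesis
    by (simp add: lborel_distr_plus)
qed

lemma nn_integral_lborel_reflect:
  fixes f :: "'a::euclidean_space \<Rightarrow> ennreal"
  assumes [measurable]: "f \<in> borel_measurable borel"
  shows "(\<integral>\<^sup>+x. f (c - x) \<partial>lborel) = (\<integral>\<^sup>+x. f x \<partial>lborel)"
proof -
  have "(\<integral>\<^sup>+x. f x \<partial>lborel) = (\<integral>\<^sup>+x. f x \<partial>density (distr lborel borel (\<lambda>x. c + (- 1) *\<^sub>R x)) (\<lambda>_. \<bar>- 1 :: real\<bar>^DIM('a)))"
    by (subst lborel_affine[of "- 1" c]) auto
  also have "\<dots> = (\<integral>\<^sup>+x. f (c - x) \<partial>lborel)"
    by (simp add: density_1 nn_integral_distr)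
  finally show ?thesis by simp
qed

lemma borel_measurable_matrix_vector_mult [measurable]:
  "(\<lambda>x. B *v x) \<in> borel_measurable borel" for B :: "real^'n^'m"
  by (intro borel_measurable_continuous_onI matrix_vector_mult_linear_continuous_on)

text \<open>The functional \<open>f \<mapsto> \<integral> f (B x) dx\<close> is translation invariant, because \<open>B\<close> is onto. The Fubini argument for
the uniqueness of an invariant measure then shows that it is proportional to Lebesgue measure.\<close>
lemma lborel_linear_image_proportional:
  fixes B :: "real^'n^'n" and f g :: "real^'n \<Rightarrow> ennreal"
  assumes "invertible B" and [measurable]: "f \<in> borel_measurable borel" "g \<in> borel_measurable borel"
  shows "(\<integral>\<^sup>+x. f (B *v x) \<partial>lborel) * (\<integral>\<^sup>+x. g x \<partial>lborel) = (\<integral>\<^sup>+x. g (B *v x) \<partial>lborel) * (\<integral>\<^sup>+x. f x \<partial>lborel)"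
proof -
  obtain C where C: "B ** C = mat 1"
    using assms(1) by (auto simp: invertible_def)
  have BC: "B *v (C *v y) = y" for y
    by (simp add: matrix_vector_mul_assoc C)
  have "(\<integral>\<^sup>+x. f (B *v x) \<partial>lborel) * (\<integral>\<^sup>+x. g x \<partial>lborel) = (\<integral>\<^sup>+x. (\<integral>\<^sup>+y. f (B *v x) * g (B *v x + y) \<partial>lborel) \<partial>lborel)"
    by (simp add: nn_integral_cmult nn_integral_multc nn_integral_lborel_translate)
  also have "\<dots> = (\<integral>\<^sup>+y. (\<integral>\<^sup>+x. f (B *v x) * g (B *v x + y) \<partial>lborel) \<partial>lborel)"
    by (intro lborel_pair.Fubini') measurable
  also have "\<dots> = (\<integral>\<^sup>+y. (\<integral>\<^sup>+x. f (B *v x - y) * g (B *v x) \<partial>lborel) \<partial>lborel)"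
  proof (rule nn_integral_cong)
    \<comment> \<open>Substituting \<open>x - C y\<close> for \<open>x\<close> shifts \<open>B x\<close> by \<open>- y\<close>.\<close>
    show "(\<integral>\<^sup>+x. f (B *v x) * g (B *v x + y) \<partial>lborel) = (\<integral>\<^sup>+x. f (B *v x - y) * g (B *v x) \<partial>lborel)"
      for y using nn_integral_lborel_translate[of "\<lambda>x. f (B *v x) * g (B *v x + y)" "- (C *v y)"]
      by (simp add: matrix_vector_mult_diff_distrib BC)
  qed
  also have "\<dots> = (\<integral>\<^sup>+x. (\<integral>\<^sup>+y. f (B *v x - y) * g (B *v x) \<partial>lborel) \<partial>lborel)"
    by (intro lborel_pair.Fubini') measurable
  also have "\<dots> = (\<integral>\<^sup>+x. g (B *v x) \<partial>lborel) * (\<integral>\<^sup>+x. f x \<partial>lborel)"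
    by (simp add: nn_integral_cmult nn_integral_multc nn_integral_lborel_reflect mult.commute)
  finally show ?thesis .
qed

text \<open>The integral factorises over an orthonormal basis into one-dimensional normal integrals.\<close>
lemma nn_integral_standard_gaussian:
  "(\<integral>\<^sup>+x. ennreal (exp (- (x \<bullet> (x :: 'a::euclidean_space)) / 2)) \<partial>lborel) = ennreal (sqrt ((2 * pi) ^ DIM('a)))"
proof -
  interpret product_sigma_finite "\<lambda>_::'a. lborel :: real measure"
    by unfold_locales
  have one: "(\<integral>\<^sup>+t. ennreal (exp (- (t * t) / 2)) \<partial>lborel) = ennreal (sqrt (2 * pi))"
  proof -
    interpret prob_space "density lborel std_normal_density"
      by (rule prob_space_normal_density) simp
    have "ennreal (sqrt (2 * pi)) * (\<integral>\<^sup>+t. ennreal (std_normal_density t) \<partial>lborel) = ennreal (sqrt (2 * pi))"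
      using emeasure_space_1 by (simp add: emeasure_density)
    also have "ennreal (sqrt (2 * pi)) * (\<integral>\<^sup>+t. ennreal (std_normal_density t) \<partial>lborel)
      = (\<integral>\<^sup>+t. ennreal (sqrt (2 * pi)) * ennreal (std_normal_density t) \<partial>lborel)"
      by (simp add: nn_integral_cmult)
    also have "\<dots> = (\<integral>\<^sup>+t. ennreal (exp (- (t * t) / 2)) \<partial>lborel)"
      by (intro nn_integral_cong)
        (auto simp: std_normal_density_def power2_eq_square simp flip: ennreal_mult)
    finally show ?thesis .
  qed
  have "(\<integral>\<^sup>+x. ennreal (exp (- (x \<bullet> (x::'a)) / 2)) \<partial>lborel)
    = (\<integral>\<^sup>+f. ennreal (exp (- ((\<Sum>b\<in>Basis. f b *\<^sub>R b) \<bullet> (\<Sum>b\<in>Basis. f b *\<^sub>R b :: 'a)) / 2)) \<partial>(\<Pi>\<^sub>M b\<in>Basis. lborel))"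
    by (subst lborel_eq) (simp add: nn_integral_distr)
  also have "\<dots> = (\<integral>\<^sup>+f. (\<Prod>b\<in>(Basis::'a set). ennreal (exp (- (f b * f b) / 2))) \<partial>(\<Pi>\<^sub>M b\<in>Basis. lborel))"
  proof (intro nn_integral_cong)
    fix f :: "'a \<Rightarrow> real"
    have "(\<Sum>b\<in>Basis. f b *\<^sub>R b) \<bullet> (\<Sum>b\<in>Basis. f b *\<^sub>R b :: 'a) = (\<Sum>b\<in>Basis. f b * f b)"
      by (subst euclidean_inner) (simp add: inner_sum_left inner_Basis if_distrib cong: if_cong)
    then show "ennreal (exp (- ((\<Sum>b\<in>Basis. f b *\<^sub>R b) \<bullet> (\<Sum>b\<in>Basis. f b *\<^sub>R b :: 'a)) / 2))
      = (\<Prod>b\<in>(Basis::'a set). ennreal (exp (- (f b * f b) / 2)))"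
      by (simp add: prod_ennreal exp_sum sum_negf[symmetric] sum_divide_distrib)
  qed
  also have "\<dots> = (\<Prod>b\<in>(Basis::'a set). ennreal (sqrt (2 * pi)))"
    using one by (subst product_nn_integral_prod) simp_all
  also have "\<dots> = ennreal (sqrt ((2 * pi) ^ DIM('a)))"
    by (simp only: prod_constant ennreal_power real_sqrt_power real_sqrt_ge_zero[of "2 * pi"] pi_ge_zero mult_nonneg_nonneg zero_le_numeral)
  finally show ?thesis .
qed

lemma nn_integral_lborel_diagonal:
  fixes B :: "real^'n^'n" and f :: "real^'n \<Rightarrow> ennreal"
  assumes diag: "\<And>i j. i \<noteq> j \<Longrightarrow> B $ i $ j = 0" and "det B \<noteq> 0" and [measurable]: "f \<in> borel_measurable borel"
  shows "(\<integral>\<^sup>+x. f x \<partial>lborel) = ennreal \<bar>det B\<bar> * (\<integral>\<^sup>+x. f (B *v x) \<partial>lborel)"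
proof -
  define c where "c b = b \<bullet> (B *v b)" for b
  have Basis: "(Basis :: (real^'n) set) = range (\<lambda>i. axis i 1)"
    by (auto simp: Basis_vec_def)
  have inj: "inj (\<lambda>i::'n. axis i (1::real))"
    by (auto simp: inj_def axis_eq_axis)
  have Bx: "(B *v x) $ i = B $ i $ i * x $ i" for x i
  proof -
    have "(B *v x) $ i = (\<Sum>j\<in>UNIV. if j = i then B $ i $ i * x $ i else 0)"
      unfolding matrix_vector_mult_def vec_lambda_beta by (intro sum.cong) (auto simp: diag)
    then show ?thesis by simp
  qed
  have c: "c (axis i 1) = B $ i $ i" for i
    by (simp add: c_def inner_axis' Bx)
  have det: "det B = (\<Prod>i\<in>UNIV. B $ i $ i)"
    by (rule det_diagonal) (rule diag)
  have "B *v x = 0 + (\<Sum>j\<in>Basis. (c j * (x \<bullet> j)) *\<^sub>R j)" for x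
    unfolding Basis by (subst sum.reindex[OF inj])
      (simp add: c vec_eq_iff Bx inner_axis, simp add: axis_def if_distrib cong: if_cong)
  then have T: "(\<lambda>x. 0 + (\<Sum>j\<in>Basis. (c j * (x \<bullet> j)) *\<^sub>R j)) = (\<lambda>x. B *v x)"
    by auto
  have p: "(\<Prod>j\<in>Basis. \<bar>c j\<bar>) = \<bar>det B\<bar>"
    unfolding Basis det by (subst prod.reindex[OF inj]) (simp add: c abs_prod)
  have "c j \<noteq> 0" if "j \<in> Basis" for j
    using that assms(2) by (auto simp: Basis c det)
  from lborel_affine_euclidean[of c 0, OF this, unfolded T p]
  have "(\<integral>\<^sup>+x. f x \<partial>lborel) = (\<integral>\<^sup>+x. f x \<partial>density (distr lborel borel (\<lambda>x. B *v x)) (\<lambda>_. ennreal \<bar>det B\<bar>))"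
    by simp
  then show ?thesis
    by (simp add: nn_integral_density nn_integral_distr nn_integral_cmult)
qed

text \<open>A test function with finite nonzero integral that is invariant under isometries. Its transform under
\<open>B\<close> fixes the proportionality factor of \<open>B\<close>.\<close>
abbreviation (input) std_gauss :: "real^'n \<Rightarrow> ennreal" where
  "std_gauss x \<equiv> ennreal (exp (- (x \<bullet> x) / 2))"

lemma std_gauss_integral_pos_finite:
  "(\<integral>\<^sup>+x. std_gauss (x :: real^'n) \<partial>lborel) \<noteq> 0" "(\<integral>\<^sup>+x. std_gauss (x :: real^'n) \<partial>lborel) \<noteq> \<infinity>"
  unfolding nn_integral_standard_gaussian by (simp_all add: ennreal_eq_0_iff not_le)

lemma ennreal_cancel_finite_factor: "(a :: ennreal) * G = b * G \<Longrightarrow> G \<noteq> 0 \<Longrightarrow> G \<noteq> \<infinity> \<Longrightarrow> a = b"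
  by (metis ennreal_mult_cancel_left infinity_ennreal_def mult.commute)

lemma lborel_linear_image_scale:
  fixes B :: "real^'n^'n" and f :: "real^'n \<Rightarrow> ennreal"
  assumes B: "invertible B" "(\<integral>\<^sup>+x. std_gauss (B *v x) \<partial>lborel) = c * (\<integral>\<^sup>+x. std_gauss (x :: real^'n) \<partial>lborel)"
    and f: "f \<in> borel_measurable borel"
  shows "(\<integral>\<^sup>+x. f (B *v x) \<partial>lborel) = c * (\<integral>\<^sup>+x. f x \<partial>lborel)"
proof (rule ennreal_cancel_finite_factor[OF _ std_gauss_integral_pos_finite])
  have "(\<integral>\<^sup>+x. f (B *v x) \<partial>lborel) * (\<integral>\<^sup>+x. std_gauss (x :: real^'n) \<partial>lborel)
    = (\<integral>\<^sup>+x. std_gauss (B *v x) \<partial>lborel) * (\<integral>\<^sup>+x. f x \<partial>lborel)"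
    using lborel_linear_image_proportional[OF B(1) f, of std_gauss] by simp
  also have "\<dots> = c * (\<integral>\<^sup>+x. f x \<partial>lborel) * (\<integral>\<^sup>+x. std_gauss (x :: real^'n) \<partial>lborel)"
    by (simp only: B(2) mult_ac)
  finally show "(\<integral>\<^sup>+x. f (B *v x) \<partial>lborel) * (\<integral>\<^sup>+x. std_gauss (x :: real^'n) \<partial>lborel)
    = c * (\<integral>\<^sup>+x. f x \<partial>lborel) * (\<integral>\<^sup>+x. std_gauss (x :: real^'n) \<partial>lborel)" .
qed

lemma involution_abs_det:
  fixes B :: "real^'n^'n"
  assumes "\<And>x. B *v (B *v x) = x"
  shows "\<bar>det B\<bar> = 1"
proof -
  have "B ** B = mat 1"
    using assms by (simp add: matrix_eq flip: matrix_vector_mul_assoc)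
  from arg_cong[OF this, of det] have "det B * det B = 1"
    by (simp add: det_mul)
  then have "\<bar>det B\<bar> * \<bar>det B\<bar> = 1"
    by simp
  then show ?thesis
    by (metis abs_ge_zero abs_mult_self_eq power2_eq_1_iff power2_eq_square abs_1 abs_minus_cancel)
qed

text \<open>A coordinate swap is an isometry, so it preserves the Gaussian test function and has factor one.\<close>
lemma nn_integral_lborel_swap:
  fixes m n :: "'n::finite" and f :: "real^'n \<Rightarrow> ennreal"
  defines "B \<equiv> (\<chi> i j. mat 1 $ i $ Transposition.transpose m n j) :: real^'n^'n"
  assumes "f \<in> borel_measurable borel"
  shows "\<bar>det B\<bar> = 1" "(\<integral>\<^sup>+x. f (B *v x) \<partial>lborel) = (\<integral>\<^sup>+x. f x \<partial>lborel)"
proof -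
  have Bx: "(B *v x) $ i = x $ Transposition.transpose m n i" for x i
  proof -
    have "(B *v x) $ i = (\<Sum>j\<in>UNIV. if j = Transposition.transpose m n i then x $ j else 0)"
      unfolding matrix_vector_mult_def vec_lambda_beta B_def
      by (intro sum.cong) (auto simp: mat_def)
    then show ?thesis by simp
  qed
  show det: "\<bar>det B\<bar> = 1"
    by (rule involution_abs_det) (simp add: vec_eq_iff Bx)
  have "(B *v x) \<bullet> (B *v x) = x \<bullet> x" for x
    unfolding inner_vec_def Bx
    by (rule sum.reindex_bij_betw[of "Transposition.transpose m n" UNIV UNIV "\<lambda>i. x $ i \<bullet> x $ i"]) simp
  then show "(\<integral>\<^sup>+x. f (B *v x) \<partial>lborel) = (\<integral>\<^sup>+x. f x \<partial>lborel)"
    using lborel_linear_image_scale[of B 1 f] det assms(2) by (auto simp: invertible_det_nz)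
qed

text \<open>Let \<open>D\<close> reverse the sign of the coordinate \<open>n\<close>. Then \<open>D E D\<close> is the inverse shear of \<open>E\<close>, and \<open>D\<close>
preserves Lebesgue measure. Hence the factor \<open>c\<close> of \<open>E\<close> satisfies \<open>c\<^sup>2 = 1\<close>, without splitting
off two coordinates of the space.\<close>
lemma nn_integral_lborel_shear:
  fixes m n :: "'n::finite" and f :: "real^'n \<Rightarrow> ennreal"
  defines "E \<equiv> (\<chi> i j. of_bool (i = m \<and> j = n \<or> i = j)) :: real^'n^'n"
  assumes mn: "m \<noteq> n" and f: "f \<in> borel_measurable borel"
  shows "\<bar>det E\<bar> = 1" "(\<integral>\<^sup>+x. f (E *v x) \<partial>lborel) = (\<integral>\<^sup>+x. f x \<partial>lborel)"
proof -
  define D :: "real^'n^'n" where "D = (\<chi> i j. if i = j then if i = n then - 1 else 1 else 0)"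
  define G where "G = (\<integral>\<^sup>+x. std_gauss (x :: real^'n) \<partial>lborel)"
  have G: "G \<noteq> 0" "G \<noteq> \<infinity>"
    unfolding G_def by (rule std_gauss_integral_pos_finite)+
  have Ex: "(E *v x) $ i = x $ i + (if i = m then x $ n else 0)" for x i
  proof -
    have "(E *v x) $ i = (\<Sum>j\<in>UNIV. (if j = i then x $ j else 0) + (if j = n then if i = m then x $ n else 0 else 0))"
      unfolding matrix_vector_mult_def vec_lambda_beta E_def using mn by (intro sum.cong) auto
    then show ?thesis by (simp add: sum.distrib)
  qed
  have Dx: "(D *v x) $ i = (if i = n then - (x $ i) else x $ i)" for x i
  proof -
    have "(D *v x) $ i = (\<Sum>j\<in>UNIV. if j = i then if i = n then - (x $ i) else x $ i else 0)"
      unfolding matrix_vector_mult_def vec_lambda_beta D_def by (intro sum.cong) auto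
    then show ?thesis by simp
  qed
  have DE: "D *v (E *v (D *v (E *v x))) = x" for x
    using mn by (simp add: vec_eq_iff Dx Ex)
  have detD: "\<bar>det D\<bar> = 1"
    by (rule involution_abs_det) (simp add: vec_eq_iff Dx)
  have "\<bar>det (D ** E)\<bar> = 1"
    by (rule involution_abs_det) (simp add: DE flip: matrix_vector_mul_assoc)
  then show detE: "\<bar>det E\<bar> = 1"
    by (simp add: det_mul abs_mult detD)
  have D: "(\<integral>\<^sup>+x. h (D *v x) \<partial>lborel) = (\<integral>\<^sup>+x. h x \<partial>lborel)"
    if "h \<in> borel_measurable borel" for h :: "real^'n \<Rightarrow> ennreal"
    using nn_integral_lborel_diagonal[of D h] that detD by (auto simp: D_def)
  define c where "c = (\<integral>\<^sup>+x. std_gauss (E *v x) \<partial>lborel) / G"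
  have cG: "(\<integral>\<^sup>+x. std_gauss (E *v x) \<partial>lborel) = c * G"
    unfolding c_def ennreal_divide_times using G
    by (simp add: ennreal_divide_self less_top)
  have E: "(\<integral>\<^sup>+x. h (E *v x) \<partial>lborel) = c * (\<integral>\<^sup>+x. h x \<partial>lborel)"
    if "h \<in> borel_measurable borel" for h :: "real^'n \<Rightarrow> ennreal"
    by (rule lborel_linear_image_scale) (use that detE cG in \<open>auto simp: G_def invertible_det_nz\<close>)
  have "G = (\<integral>\<^sup>+x. std_gauss (D *v (E *v (D *v (E *v x)))) \<partial>lborel)"
    by (simp only: DE G_def)
  also have "\<dots> = c * (\<integral>\<^sup>+x. std_gauss (D *v (E *v (D *v x))) \<partial>lborel)"
    by (rule E[of "\<lambda>x. std_gauss (D *v (E *v (D *v x)))"]) measurable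
  also have "(\<integral>\<^sup>+x. std_gauss (D *v (E *v (D *v x))) \<partial>lborel) = (\<integral>\<^sup>+x. std_gauss (D *v (E *v x)) \<partial>lborel)"
    by (rule D[of "\<lambda>x. std_gauss (D *v (E *v x))"]) measurable
  also have "\<dots> = c * (\<integral>\<^sup>+x. std_gauss (D *v x) \<partial>lborel)"
    by (rule E[of "\<lambda>x. std_gauss (D *v x)"]) measurable
  also have "(\<integral>\<^sup>+x. std_gauss (D *v x) \<partial>lborel) = G"
    unfolding G_def by (rule D[of std_gauss]) measurable
  finally have "1 * G = (c * c) * G"
    by (simp add: mult.assoc)
  from ennreal_cancel_finite_factor[OF this G] have cc: "c * c = 1" ..
  have "c = 1"
  proof (cases c)
    case (real r)
    then have "ennreal (r * r) = ennreal 1"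
      using cc by (simp add: ennreal_mult)
    then have "r * r = 1"
      using real by (subst (asm) ennreal_inj) auto
    then have "r = 1"
      using real by (metis abs_of_nonneg power2_eq_1_iff power2_eq_square abs_1 abs_minus_cancel)
    then show ?thesis
      using real by simp
  qed (use cc in simp)
  then show "(\<integral>\<^sup>+x. f (E *v x) \<partial>lborel) = (\<integral>\<^sup>+x. f x \<partial>lborel)"
    using E[OF f] by simp
qed

text \<open>The formula is multiplicative in the matrix, so it is enough to know it for diagonal matrices, swaps and
shears. Matrices with a zero row are excluded by the determinant condition.\<close>
lemma nn_integral_lborel_linear:
  fixes B :: "real^'n^'n" and f :: "real^'n \<Rightarrow> ennreal"
  assumes "det B \<noteq> 0" and "f \<in> borel_measurable borel"
  shows "(\<integral>\<^sup>+x. f x \<partial>lborel) = ennreal \<bar>det B\<bar> * (\<integral>\<^sup>+x. f (B *v x) \<partial>lborel)"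
proof -
  have "det B \<noteq> 0 \<longrightarrow> (\<forall>f::_ \<Rightarrow> ennreal. f \<in> borel_measurable borel \<longrightarrow>
    (\<integral>\<^sup>+x. f x \<partial>lborel) = ennreal \<bar>det B\<bar> * (\<integral>\<^sup>+x. f (B *v x) \<partial>lborel))" (is "?P B")
  proof (rule induct_matrix_elementary_alt)
    fix A B :: "real^'n^'n" assume A: "?P A" and B: "?P B"
    show "?P (A ** B)"
    proof (intro impI allI)
      fix f :: "real^'n \<Rightarrow> ennreal"
      assume "det (A ** B) \<noteq> 0" and [measurable]: "f \<in> borel_measurable borel"
      then have nz: "det A \<noteq> 0" "det B \<noteq> 0" by (auto simp: det_mul)
      have "(\<integral>\<^sup>+x. f x \<partial>lborel) = ennreal \<bar>det A\<bar> * (\<integral>\<^sup>+x. f (A *v x) \<partial>lborel)"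
        by (rule A[rule_format]) (use nz in auto)
      also have "(\<integral>\<^sup>+x. f (A *v x) \<partial>lborel) = ennreal \<bar>det B\<bar> * (\<integral>\<^sup>+x. f (A *v (B *v x)) \<partial>lborel)"
        by (rule B[rule_format, of "\<lambda>x. f (A *v x)"]) (use nz in auto)
      finally show "(\<integral>\<^sup>+x. f x \<partial>lborel) = ennreal \<bar>det (A ** B)\<bar> * (\<integral>\<^sup>+x. f ((A ** B) *v x) \<partial>lborel)"
        by (simp add: det_mul abs_mult ennreal_mult' mult.assoc flip: matrix_vector_mul_assoc)
    qed
  next
    fix A :: "real^'n^'n" and i assume "row i A = 0"
    then show "?P A" by (simp add: det_zero_row)
  next
    fix A :: "real^'n^'n" assume "\<And>i j. i \<noteq> j \<Longrightarrow> A $ i $ j = 0"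
    then show "?P A" using nn_integral_lborel_diagonal by blast
  next
    fix m n :: 'n assume "m \<noteq> n"
    show "?P (\<chi> i j. mat 1 $ i $ Transposition.transpose m n j)"
      using nn_integral_lborel_swap[of _ m n] by simp
  next
    fix m n :: 'n assume "m \<noteq> n"
    show "?P (\<chi> i j. of_bool (i = m \<and> j = n \<or> i = j))"
      using nn_integral_lborel_shear[OF \<open>m \<noteq> n\<close>] by simp
  qed
  with assms show ?thesis
    by blast
qed

lemma matrix_inv_mult:
  fixes S :: "real^'n^'n"
  assumes "invertible S"
  shows "S ** matrix_inv S = mat 1" "matrix_inv S ** S = mat 1"
  using someI_ex[of "\<lambda>A'. S ** A' = mat 1 \<and> A' ** S = mat 1"] assms
  unfolding matrix_inv_def invertible_def by auto

lemma symmetric_matrix_inner: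
  fixes S :: "real^'n^'n"
  assumes "transpose S = S"
  shows "x \<bullet> (S *v y) = (S *v x) \<bullet> y"
  by (metis assms dot_lmul_matrix vector_transpose_matrix)

text \<open>Gram-Schmidt for the inner product \<open>x \<bullet> S y\<close>: fewer than \<open>n\<close> vectors \<open>S e\<close> do not span the space, so
some nonzero \<open>z\<close> is orthogonal to all of them, and \<open>z\<close> can be scaled to length one because \<open>z \<bullet> S z > 0\<close>.\<close>
lemma pos_def_orthonormal_set:
  fixes S :: "real^'n^'n"
  assumes S: "pos_def S"
  shows "k \<le> CARD('n) \<Longrightarrow> \<exists>E. finite E \<and> card E = k \<and> (\<forall>x\<in>E. \<forall>y\<in>E. x \<bullet> (S *v y) = (if x = y then 1 else 0))"
proof (induction k)
  case 0
  show ?case by (intro exI[of _ "{}"]) auto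
next
  case (Suc k)
  then obtain E where E: "finite E" "card E = k"
    "\<And>x y. x \<in> E \<Longrightarrow> y \<in> E \<Longrightarrow> x \<bullet> (S *v y) = (if x = y then 1 else 0)"
    by auto
  have "dim ((*v) S ` E) \<le> card ((*v) S ` E)"
    using E(1) by (simp add: dim_le_card')
  also have "\<dots> < DIM(real^'n)"
    using Suc.prems E card_image_le[OF E(1), of "(*v) S"] by simp
  finally obtain z where z: "z \<noteq> 0" "\<And>y. y \<in> span ((*v) S ` E) \<Longrightarrow> orthogonal z y"
    using orthogonal_to_subspace_exists by blast
  have zE: "z \<bullet> (S *v y) = 0" if "y \<in> E" for y
    using z(2)[of "S *v y"] that by (auto simp: orthogonal_def intro: span_base)
  have sym: "transpose S = S" and pos: "z \<bullet> (S *v z) > 0"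
    using S z(1) by (auto simp: pos_def_def)
  define e where "e = (1 / sqrt (z \<bullet> (S *v z))) *\<^sub>R z"
  have e1: "e \<bullet> (S *v e) = 1"
    using pos by (simp add: e_def matrix_vector_mult_scaleR)
  have eE: "e \<bullet> (S *v y) = 0" "y \<bullet> (S *v e) = 0" if "y \<in> E" for y
    using zE[OF that] by (simp_all add: e_def symmetric_matrix_inner[OF sym, of y] inner_commute[of "S *v y"])
  then have "e \<notin> E"
    using e1 by auto
  then show ?case
    using E e1 eE by (intro exI[of _ "insert e E"]) auto
qed

text \<open>The columns of \<open>B\<close> are an orthonormal basis for the inner product \<open>x \<bullet> S y\<close>.\<close>
lemma pos_def_congruent_mat_1:
  fixes S :: "real^'n^'n"
  assumes S: "pos_def S"
  obtains B :: "real^'n^'n" where "transpose B ** S ** B = mat 1"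
proof -
  obtain E where E: "finite E" "card E = CARD('n)"
    "\<And>x y. x \<in> E \<Longrightarrow> y \<in> E \<Longrightarrow> x \<bullet> (S *v y) = (if x = y then 1 else 0)"
    using pos_def_orthonormal_set[OF S order_refl] by auto
  obtain b where b: "bij_betw b (UNIV :: 'n set) E"
    using E(1,2) finite_same_card_bij[of "UNIV :: 'n set" E] by auto
  define B :: "real^'n^'n" where "B = (\<chi> i j. b j $ i)"
  have col: "column j B = b j" for j
    by (simp add: B_def column_def vec_eq_iff)
  have "(transpose B ** (S ** B)) $ i $ j = b i \<bullet> (S *v b j)" for i j
  proof -
    have "(transpose B ** (S ** B)) $ i $ j = row i (transpose B) \<bullet> column j (S ** B)"
      by (simp add: matrix_mult_dot row_def column_def matrix_matrix_mult_def inner_vec_def)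
    also have "column j (S ** B) = S *v b j"
      by (simp add: vec_eq_iff column_def matrix_matrix_mult_def matrix_vector_mult_def B_def)
    finally show ?thesis
      by (simp add: col)
  qed
  moreover have "b i \<bullet> (S *v b j) = (if i = j then 1 else 0)" for i j
    using E(3)[of "b i" "b j"] b by (auto simp: bij_betw_def inj_def)
  ultimately have "transpose B ** S ** B = mat 1"
    by (simp add: vec_eq_iff mat_def matrix_mul_assoc[symmetric])
  then show thesis ..
qed

text \<open>The substitution \<open>x = B z\<close> with \<open>B\<^sup>T S B = 1\<close> turns the exponent into \<open>z \<bullet> z\<close>, and taking determinants
gives \<open>\<bar>det B\<bar> = 1 / sqrt (det S)\<close>.\<close>
lemma nn_integral_gaussian:
  fixes S :: "real^'n^'n"
  assumes S: "pos_def S"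
  shows "det S > 0"
    and "(\<integral>\<^sup>+x. ennreal (exp (- (x \<bullet> (S *v x)) / 2)) \<partial>lborel) = ennreal (sqrt ((2 * pi) ^ CARD('n) / det S))"
proof -
  obtain B :: "real^'n^'n" where B: "transpose B ** S ** B = mat 1"
    using pos_def_congruent_mat_1[OF S] .
  have det: "det S * (det B)\<^sup>2 = 1"
    using arg_cong[OF B, of det] by (simp add: det_mul power2_eq_square mult_ac)
  then show pos: "det S > 0"
    by (metis zero_le_power2 zero_less_mult_pos2 zero_less_one order_le_less mult_zero_right)
  have "(det B)\<^sup>2 = 1 / det S"
    using det pos by (simp add: field_simps)
  then have absB: "\<bar>det B\<bar> = sqrt (1 / det S)"
    by (metis real_sqrt_abs)
  have quad: "(B *v x) \<bullet> (S *v (B *v x)) = x \<bullet> x" for x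
  proof -
    have "(B *v x) \<bullet> (S *v (B *v x)) = x \<bullet> (transpose B *v (S *v (B *v x)))"
      by (metis dot_lmul_matrix transpose_matrix_vector inner_commute)
    also have "transpose B *v (S *v (B *v x)) = x"
      using B by (simp add: matrix_vector_mul_assoc matrix_mul_assoc)
    finally show ?thesis .
  qed
  have "det B \<noteq> 0"
    using det by auto
  then have "(\<integral>\<^sup>+x. ennreal (exp (- (x \<bullet> (S *v x)) / 2)) \<partial>lborel)
    = ennreal \<bar>det B\<bar> * (\<integral>\<^sup>+x. ennreal (exp (- ((B *v x) \<bullet> (S *v (B *v x))) / 2)) \<partial>lborel)"
    by (subst nn_integral_lborel_linear[of B]) auto
  also have "\<dots> = ennreal (sqrt (1 / det S)) * ennreal (sqrt ((2 * pi) ^ CARD('n)))"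
    unfolding quad absB by (subst nn_integral_standard_gaussian) simp
  also have "\<dots> = ennreal (sqrt ((2 * pi) ^ CARD('n) / det S))"
    using pos by (simp add: real_sqrt_divide flip: ennreal_mult)
  finally show "(\<integral>\<^sup>+x. ennreal (exp (- (x \<bullet> (S *v x)) / 2)) \<partial>lborel) = ennreal (sqrt ((2 * pi) ^ CARD('n) / det S))" .
qed

lemma pos_def_add: "pos_def P \<Longrightarrow> pos_def Q \<Longrightarrow> pos_def (P + Q)"
  unfolding pos_def_def
  by (auto simp: matrix_vector_mult_add_rdistrib inner_add_right transpose_def vec_eq_iff add_pos_pos)

lemma pos_def_invertible: "pos_def S \<Longrightarrow> invertible S"
  using nn_integral_gaussian(1)[of S] by (simp add: invertible_det_nz)

lemma pos_def_matrix_inv: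
  fixes S :: "real^'n^'n"
  assumes S: "pos_def S"
  shows "pos_def (matrix_inv S)"
proof -
  note inv = matrix_inv_mult[OF pos_def_invertible[OF S]]
  have sym: "transpose S = S"
    using S by (simp add: pos_def_def)
  have "transpose (matrix_inv S) ** S = mat 1"
    using arg_cong[OF inv(1), of transpose] by (simp add: matrix_transpose_mul sym transpose_mat)
  then have "transpose (matrix_inv S) = matrix_inv S"
    by (metis inv(1) matrix_mul_assoc matrix_mul_lid matrix_mul_rid)
  moreover have "x \<bullet> (matrix_inv S *v x) > 0" if "x \<noteq> 0" for x
  proof -
    let ?y = "matrix_inv S *v x"
    have Sy: "S *v ?y = x"
      by (simp add: matrix_vector_mul_assoc inv)
    then have "?y \<noteq> 0"
      using that by (metis matrix_vector_mult_0_right)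
    then have "?y \<bullet> (S *v ?y) > 0"
      using S by (simp add: pos_def_def)
    then show ?thesis
      by (simp add: Sy inner_commute)
  qed
  ultimately show ?thesis
    by (simp add: pos_def_def)
qed

section \<open>Multivariate normal densities and their convolution\<close>

lemma mvn_density_translate: "mvn_density (\<mu> + v) S x = mvn_density v S (x - \<mu>)"
  by (simp add: mvn_density_def algebra_simps)

lemma mvn_density_center: "mvn_density \<mu> S x = mvn_density 0 S (x - \<mu>)"
  using mvn_density_translate[of \<mu> 0] by simp

lemma mvn_density_pos:
  assumes "pos_def S" shows "mvn_density \<mu> S x > 0"
  using nn_integral_gaussian(1)[OF assms] by (simp add: mvn_density_def)

lemma mvn_density_le:
  assumes "pos_def S" shows "mvn_density \<mu> S x \<le> mvn_density 0 S 0"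
proof -
  have "0 \<le> (x - \<mu>) \<bullet> (matrix_inv S *v (x - \<mu>))"
    using pos_def_matrix_inv[OF assms] unfolding pos_def_def by (cases "x = \<mu>") (auto intro: less_imp_le)
  then show ?thesis
    using nn_integral_gaussian(1)[OF assms] by (simp add: mvn_density_def divide_right_mono)
qed

lemma continuous_on_mvn_density:
  assumes "pos_def S"
  shows "continuous_on UNIV (mvn_density \<mu> S)"
proof -
  have "sqrt ((2 * pi) ^ CARD('a) * det S) \<noteq> 0"
    using nn_integral_gaussian(1)[OF assms] by simp
  then show ?thesis
    unfolding mvn_density_def
    by (intro continuous_intros matrix_vector_mult_linear_continuous_on
        continuous_on_compose2[OF matrix_vector_mult_linear_continuous_on]) auto
qed

lemma measurable_mvn_density [measurable (raw)]:
  assumes [measurable]: "f \<in> borel_measurable N" "g \<in> borel_measurable N"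
  shows "(\<lambda>z. mvn_density (f z) S (g z)) \<in> borel_measurable N"
  unfolding mvn_density_def by measurable

lemma det_matrix_inv:
  assumes "pos_def S" shows "det (matrix_inv S) = 1 / det S"
  using arg_cong[OF matrix_inv_mult(1)[OF pos_def_invertible[OF assms]], of det] nn_integral_gaussian(1)[OF assms]
  by (simp add: det_mul field_simps)

lemma nn_integral_mvn_density:
  fixes S :: "real^'d^'d"
  assumes S: "pos_def S"
  shows "(\<integral>\<^sup>+x. ennreal (mvn_density \<mu> S x) \<partial>lborel) = 1"
proof -
  define K where "K = sqrt ((2 * pi) ^ CARD('d) * det S)"
  have K: "K > 0"
    using nn_integral_gaussian(1)[OF S] by (simp add: K_def)
  have "(\<integral>\<^sup>+x. ennreal (mvn_density \<mu> S x) \<partial>lborel) = (\<integral>\<^sup>+x. ennreal (mvn_density 0 S (- \<mu> + x)) \<partial>lborel)"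
    by (subst mvn_density_center) simp
  also have "\<dots> = (\<integral>\<^sup>+x. ennreal (mvn_density 0 S x) \<partial>lborel)"
    by (rule nn_integral_lborel_translate) measurable
  also have "\<dots> = (\<integral>\<^sup>+x. ennreal (exp (- (x \<bullet> (matrix_inv S *v x)) / 2)) * ennreal (1 / K) \<partial>lborel)"
    using K by (intro nn_integral_cong) (simp add: mvn_density_def K_def flip: ennreal_mult)
  also have "\<dots> = ennreal K * ennreal (1 / K)"
    by (subst nn_integral_multc, measurable)
      (simp only: nn_integral_gaussian(2)[OF pos_def_matrix_inv[OF S]] det_matrix_inv[OF S] K_def, simp)
  also have "\<dots> = 1"
    using K by (simp flip: ennreal_mult)
  finally show ?thesis .
qed

text \<open>The minimum over \<open>u\<close> of \<open>(w + u) \<bullet> Q\<^sup>-\<^sup>1 (w + u) + u \<bullet> P\<^sup>-\<^sup>1 u\<close> is attained at \<open>u = - P c\<close>, where \<open>w + u = Q c\<close>.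
Writing \<open>u = t - P c\<close> makes the terms linear in \<open>t\<close> cancel.\<close>
lemma gaussian_exponent_complete_square:
  fixes P Q :: "real^'d^'d" and w t :: "real^'d"
  assumes P: "pos_def P" and Q: "pos_def Q"
  defines "c \<equiv> matrix_inv (P + Q) *v w"
  shows "(Q *v c + t) \<bullet> (matrix_inv Q *v (Q *v c + t)) + (t - P *v c) \<bullet> (matrix_inv P *v (t - P *v c))
    = w \<bullet> (matrix_inv (P + Q) *v w) + t \<bullet> ((matrix_inv P + matrix_inv Q) *v t)"
proof -
  have sym: "transpose P = P" "transpose Q = Q"
    using P Q by (auto simp: pos_def_def)
  have inv: "matrix_inv P *v (P *v x) = x" "matrix_inv Q *v (Q *v x) = x" "P *v (matrix_inv P *v x) = x"
    "Q *v (matrix_inv Q *v x) = x" for x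
    by (simp_all add: matrix_vector_mul_assoc matrix_inv_mult pos_def_invertible P Q)
  have "w = (P + Q) *v c"
    by (simp add: c_def matrix_vector_mul_assoc matrix_inv_mult pos_def_invertible pos_def_add P Q)
  then have w: "w = P *v c + Q *v c"
    by (simp add: matrix_vector_mult_add_rdistrib)
  have "w \<bullet> c = c \<bullet> (Q *v c) + c \<bullet> (P *v c)"
    by (subst w) (simp add: inner_add_left inner_add_right inner_commute)
  moreover have "(Q *v c) \<bullet> (matrix_inv Q *v t) = c \<bullet> t" "(P *v c) \<bullet> (matrix_inv P *v t) = c \<bullet> t"
    by (simp_all add: symmetric_matrix_inner[OF sym(1), symmetric] symmetric_matrix_inner[OF sym(2), symmetric] inv)
  ultimately show ?thesis
    by (simp add: c_def[symmetric] matrix_vector_right_distrib matrix_vector_mult_diff_distrib matrix_vector_mult_add_rdistrib inv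
        inner_add_left inner_add_right inner_diff_left inner_diff_right inner_commute)
qed

text \<open>This computes the density at \<open>w\<close> of the difference of independent normal vectors with laws \<open>N(b, Q)\<close> and \<open>N(a, P)\<close>.
After completing the square the integral over \<open>t\<close> is Gaussian with matrix \<open>P\<^sup>-\<^sup>1 + Q\<^sup>-\<^sup>1 = P\<^sup>-\<^sup>1 (P + Q) Q\<^sup>-\<^sup>1\<close>,
whose determinant yields the normalising constant.\<close>
lemma mvn_density_convolution:
  fixes P Q :: "real^'d^'d"
  assumes P: "pos_def P" and Q: "pos_def Q"
  shows "(\<integral>\<^sup>+u. ennreal (mvn_density b Q (w + u)) * ennreal (mvn_density a P u) \<partial>lborel)
    = ennreal (mvn_density (b - a) (P + Q) w)"
proof -
  let ?A = "matrix_inv P" and ?B = "matrix_inv Q" and ?T = "P + Q"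
  define w' where "w' = w - (b - a)"
  define c where "c = matrix_inv ?T *v w'"
  define k where "k S = sqrt ((2 * pi) ^ CARD('d) * det S)" for S :: "real^'d^'d"
  have T: "pos_def ?T"
    by (rule pos_def_add[OF P Q])
  have AB: "pos_def (?A + ?B)"
    by (intro pos_def_add pos_def_matrix_inv P Q)
  have k: "k S > 0" if "pos_def S" for S
    using nn_integral_gaussian(1)[OF that] by (simp add: k_def)
  have "?T *v c = w'"
    by (simp add: c_def matrix_vector_mul_assoc matrix_inv_mult pos_def_invertible T)
  then have w': "w' + (- (P *v c) + t) = Q *v c + t" for t
    by (auto simp: matrix_vector_mult_add_rdistrib)
  have "?A + ?B = ?A ** ?T ** ?B"
  proof -
    have "?A *v (P *v x) = x" "Q *v (?B *v x) = x" for x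
      by (simp_all add: matrix_vector_mul_assoc matrix_inv_mult pos_def_invertible P Q)
    then show ?thesis
      by (simp add: matrix_eq matrix_vector_mult_add_rdistrib matrix_vector_right_distrib add.commute
          flip: matrix_vector_mul_assoc)
  qed
  then have detAB: "det (?A + ?B) = det ?T / (det P * det Q)"
    by (simp add: det_mul det_matrix_inv P Q)
  have "(\<integral>\<^sup>+u. ennreal (mvn_density b Q (w + u)) * ennreal (mvn_density a P u) \<partial>lborel)
    = (\<integral>\<^sup>+u. ennreal (mvn_density b Q (w + ((a - P *v c) + u))) * ennreal (mvn_density a P ((a - P *v c) + u)) \<partial>lborel)"
    by (rule nn_integral_lborel_translate[symmetric]) measurable
  also have "\<dots> = (\<integral>\<^sup>+t. ennreal (exp (- (t \<bullet> ((?A + ?B) *v t)) / 2)) * ennreal (exp (- (w' \<bullet> (matrix_inv ?T *v w')) / 2) / (k Q * k P)) \<partial>lborel)"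
  proof (rule nn_integral_cong)
    fix t
    have 1: "w + (a - P *v c + t) - b = Q *v c + t"
      using w'[of t] by (simp add: w'_def algebra_simps)
    have 2: "a - P *v c + t - a = t - P *v c"
      by simp
    have "mvn_density b Q (w + ((a - P *v c) + t)) * mvn_density a P ((a - P *v c) + t)
      = exp (- ((Q *v c + t) \<bullet> (?B *v (Q *v c + t)) + (t - P *v c) \<bullet> (?A *v (t - P *v c))) / 2) / (k Q * k P)"
      unfolding mvn_density_def 1 2 by (simp add: k_def exp_add[symmetric] diff_divide_distrib add_divide_distrib)
    also have "\<dots> = exp (- (t \<bullet> ((?A + ?B) *v t)) / 2) * (exp (- (w' \<bullet> (matrix_inv ?T *v w')) / 2) / (k Q * k P))"
      unfolding c_def gaussian_exponent_complete_square[OF P Q] by (simp add: exp_add[symmetric] diff_divide_distrib add_divide_distrib)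
    finally show "ennreal (mvn_density b Q (w + ((a - P *v c) + t))) * ennreal (mvn_density a P ((a - P *v c) + t))
      = ennreal (exp (- (t \<bullet> ((?A + ?B) *v t)) / 2)) * ennreal (exp (- (w' \<bullet> (matrix_inv ?T *v w')) / 2) / (k Q * k P))"
      using mvn_density_pos[OF P] mvn_density_pos[OF Q] k[OF P] k[OF Q]
      by (simp add: less_imp_le flip: ennreal_mult)
  qed
  also have "\<dots> = ennreal (sqrt ((2 * pi) ^ CARD('d) / det (?A + ?B))) * ennreal (exp (- (w' \<bullet> (matrix_inv ?T *v w')) / 2) / (k Q * k P))"
    by (subst nn_integral_multc, measurable) (simp only: nn_integral_gaussian(2)[OF AB])
  also have "\<dots> = ennreal (sqrt ((2 * pi) ^ CARD('d) / det (?A + ?B)) * (exp (- (w' \<bullet> (matrix_inv ?T *v w')) / 2) / (k Q * k P)))"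
    using k[OF P] k[OF Q] by (intro ennreal_mult[symmetric]) (auto simp: nn_integral_gaussian(1)[OF AB] less_imp_le)
  also have "sqrt ((2 * pi) ^ CARD('d) / det (?A + ?B)) = k Q * k P / k ?T"
    unfolding detAB k_def real_sqrt_mult[symmetric] real_sqrt_divide[symmetric]
    by (simp add: field_simps less_imp_neq[OF nn_integral_gaussian(1), THEN not_sym] P Q T)
  also have "k Q * k P / k ?T * (exp (- (w' \<bullet> (matrix_inv ?T *v w')) / 2) / (k Q * k P)) = mvn_density (b - a) ?T w"
    unfolding mvn_density_def k_def[symmetric] w'_def[symmetric] using k[OF P] k[OF Q] by simp
  finally show ?thesis .
qed

section \<open>Kullback-Leibler divergence as an integral of a nonnegative excess\<close>

lemma ennreal_add_right_cancel: "(a :: ennreal) + c = b + c \<Longrightarrow> c \<noteq> \<top> \<Longrightarrow> a = b"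
  using ennreal_add_left_cancel[of c a b] by (simp add: add.commute)

lemma ennreal_add_right_cancel_le: "(a :: ennreal) + c \<le> b + c \<Longrightarrow> c \<noteq> \<top> \<Longrightarrow> a \<le> b"
  using ennreal_add_left_cancel_le[of c a b] by (simp add: add.commute)

text \<open>The integrand \<open>s ln (s/t)\<close> of the divergence changes sign. Adding \<open>t - s\<close>, which integrates to zero for
two densities, makes it nonnegative.\<close>
definition kl_excess :: "real \<Rightarrow> real \<Rightarrow> ennreal" where
  "kl_excess s t = (if t = 0 \<and> s \<noteq> 0 then \<infinity> else ennreal (s * ln (s / t) + t - s))"

lemma measurable_kl_excess [measurable (raw)]:
  assumes [measurable]: "f \<in> borel_measurable M" "g \<in> borel_measurable M"
  shows "(\<lambda>x. kl_excess (f x) (g x)) \<in> borel_measurable M"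
  unfolding kl_excess_def by measurable

lemma measurable_kl_term [measurable (raw)]:
  assumes [measurable]: "f \<in> borel_measurable M" "g \<in> borel_measurable M"
  shows "(\<lambda>x. kl_term (f x) (g x)) \<in> borel_measurable M"
  unfolding kl_term_def by measurable

text \<open>This is \<open>ln z \<le> z - 1\<close> at \<open>z = t / s\<close>, multiplied by \<open>s\<close>.\<close>
lemma mult_ln_ge_diff:
  fixes s t :: real
  assumes "0 \<le> s" "0 < t"
  shows "s - t \<le> s * ln (s / t)"
proof (cases "s = 0")
  case False
  then have s: "s > 0" using assms by simp
  have "ln (t / s) \<le> t / s - 1"
    using s assms by (intro ln_le_minus_one) simp
  then have "s * ln (t / s) \<le> t - s"
    using mult_left_mono[of "ln (t / s)" "t / s - 1" s] s by (simp add: field_simps)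
  moreover have "ln (s / t) = - ln (t / s)"
    using s assms by (simp add: ln_div)
  ultimately show ?thesis by simp
qed (use assms in simp)

text \<open>The identity \<open>kl_term s t + t = kl_excess s t + s\<close>, with the negative part moved to the right-hand side so
that every summand is nonnegative and infinite values are allowed.\<close>
lemma kl_term_plus:
  assumes "0 \<le> s" "0 \<le> t"
  shows "e2ennreal (kl_term s t) + ennreal t = kl_excess s t + e2ennreal (- kl_term s t) + ennreal s"
proof -
  consider "s = 0" | "s > 0" "t = 0" | "s > 0" "t > 0"
    using assms by linarith
  then show ?thesis
  proof cases
    case 3
    define r where "r = s * ln (s / t)"
    have r: "0 \<le> r + t - s"
      using mult_ln_ge_diff[of s t] 3 by (simp add: r_def)
    have k: "kl_term s t = ereal r" "kl_excess s t = ennreal (r + t - s)"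
      using 3 by (auto simp: kl_term_def kl_excess_def r_def)
    show ?thesis
    proof (cases "0 \<le> r")
      case True
      then show ?thesis
        using r 3 by (simp add: k e2ennreal_ereal ennreal_neg flip: ennreal_plus)
    next
      case False
      then show ?thesis
        using r 3 by (simp add: k e2ennreal_ereal ennreal_neg flip: ennreal_plus)
    qed
  qed (auto simp: kl_term_def kl_excess_def e2ennreal_neg)
qed

lemma kl_term_neg_le:
  assumes "0 \<le> s" "0 \<le> t"
  shows "e2ennreal (- kl_term s t) \<le> ennreal t"
proof -
  have "- (s * ln (s / t)) \<le> t" if "t > 0"
    using mult_ln_ge_diff[of s t] assms that by simp
  then show ?thesis
    using assms by (cases "t = 0") (auto simp: kl_term_def e2ennreal_neg e2ennreal_ereal intro: ennreal_leI)
qed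

text \<open>The negative part of the integrand is at most \<open>t\<close>, so its integral is finite and can be subtracted; the
masses of \<open>s\<close> and \<open>t\<close> cancel.\<close>
lemma ext_integral_kl_term:
  fixes s t :: "'a \<Rightarrow> real"
  assumes [measurable]: "s \<in> borel_measurable M" "t \<in> borel_measurable M"
    and nonneg: "\<And>y. 0 \<le> s y" "\<And>y. 0 \<le> t y"
    and mass: "(\<integral>\<^sup>+y. ennreal (s y) \<partial>M) = 1" "(\<integral>\<^sup>+y. ennreal (t y) \<partial>M) = 1"
  shows "ext_integral M (\<lambda>y. kl_term (s y) (t y)) = enn2ereal (\<integral>\<^sup>+y. kl_excess (s y) (t y) \<partial>M)"
proof -
  define P where "P = (\<integral>\<^sup>+y. e2ennreal (kl_term (s y) (t y)) \<partial>M)"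
  define N where "N = (\<integral>\<^sup>+y. e2ennreal (- kl_term (s y) (t y)) \<partial>M)"
  define K where "K = (\<integral>\<^sup>+y. kl_excess (s y) (t y) \<partial>M)"
  have "N \<le> (\<integral>\<^sup>+y. ennreal (t y) \<partial>M)"
    unfolding N_def by (intro nn_integral_mono kl_term_neg_le nonneg)
  then have N: "N \<noteq> \<infinity>"
    using mass by (auto simp: top_unique)
  have "P + 1 = (\<integral>\<^sup>+y. e2ennreal (kl_term (s y) (t y)) + ennreal (t y) \<partial>M)"
    unfolding P_def mass(2)[symmetric] by (intro nn_integral_add[symmetric]) measurable
  also have "\<dots> = (\<integral>\<^sup>+y. kl_excess (s y) (t y) + e2ennreal (- kl_term (s y) (t y)) + ennreal (s y) \<partial>M)"
    by (intro nn_integral_cong kl_term_plus nonneg)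
  also have "\<dots> = (K + N) + 1"
    unfolding K_def N_def mass(1)[symmetric] by (simp add: nn_integral_add)
  finally have "P = K + N"
    by (rule ennreal_add_right_cancel) simp
  then have "enn2ereal P = enn2ereal K + enn2ereal N"
    by (simp add: plus_ennreal.rep_eq)
  moreover obtain n where "N = ennreal n" "0 \<le> n"
    using N by (cases N) auto
  ultimately have "enn2ereal P - enn2ereal N = enn2ereal K"
    by (cases "enn2ereal K") (auto simp: enn2ereal_ennreal)
  then show ?thesis
    by (simp add: ext_integral_def P_def N_def K_def)
qed

lemma ext_integral_enn2ereal: "ext_integral M (\<lambda>x. enn2ereal (f x)) = enn2ereal (\<integral>\<^sup>+x. f x \<partial>M)"
  by (simp add: ext_integral_def e2ennreal_neg zero_ennreal.rep_eq)

lemma KL_risk_eq_nn_integral: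
  fixes p q r :: "real^'d \<Rightarrow> real^'d \<Rightarrow> real"
  assumes r: "pred_density r"
    and [measurable]: "q \<theta> \<in> borel_measurable borel" and q: "\<And>y. 0 \<le> q \<theta> y" "(\<integral>\<^sup>+y. ennreal (q \<theta> y) \<partial>lborel) = 1"
    and p: "\<And>x. 0 \<le> p \<theta> x"
  shows "KL_risk p q \<theta> r
    = enn2ereal (\<integral>\<^sup>+x. (\<integral>\<^sup>+y. kl_excess (q \<theta> y) (r y x) \<partial>lborel) * ennreal (p \<theta> x) \<partial>lborel)"
proof -
  have r': "\<And>y x. 0 \<le> r y x" "\<And>x. (\<integral>\<^sup>+y. ennreal (r y x) \<partial>lborel) = 1"
    and [measurable]: "(\<lambda>(y, x). r y x) \<in> borel_measurable (borel \<Otimes>\<^sub>M borel)"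
    using r by (auto simp: pred_density_def)
  have "ext_integral lborel (\<lambda>y. kl_term (q \<theta> y) (r y x)) = enn2ereal (\<integral>\<^sup>+y. kl_excess (q \<theta> y) (r y x) \<partial>lborel)" for x
    by (rule ext_integral_kl_term) (use q r' in simp_all)
  then have "ext_integral lborel (\<lambda>y. kl_term (q \<theta> y) (r y x)) * ereal (p \<theta> x)
    = enn2ereal ((\<integral>\<^sup>+y. kl_excess (q \<theta> y) (r y x) \<partial>lborel) * ennreal (p \<theta> x))" for x
    using p by (simp add: times_ennreal.rep_eq enn2ereal_ennreal)
  then show ?thesis
    unfolding KL_risk_def by (simp only: ext_integral_enn2ereal)
qed

text \<open>The identity \<open>s ln (s/h) = s ln (s/g) + s ln (g/h)\<close> with \<open>ln (g/h)\<close> split into positive and negative part,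
so that both sides are sums of nonnegative terms.\<close>
lemma kl_excess_three_point:
  assumes "0 < s" "0 < g" "0 < h"
  shows "kl_excess s h + ennreal (s * max 0 (- ln (g / h)) + g) = kl_excess s g + ennreal (s * max 0 (ln (g / h)) + h)"
proof -
  define m where "m = max 0 (- ln (g / h))"
  have m: "0 \<le> s * m" "max 0 (ln (g / h)) = ln (g / h) + m" "0 \<le> s * (ln (g / h) + m)"
    using assms by (auto simp: m_def max_def)
  have "s * ln (s / h) = s * ln (s / g) + s * ln (g / h)"
    using assms by (simp add: ln_div algebra_simps)
  moreover have "0 \<le> s * ln (s / h) + h - s" "0 \<le> s * ln (s / g) + g - s"
    using mult_ln_ge_diff[of s h] mult_ln_ge_diff[of s g] assms by simp_all
  ultimately have "ennreal (s * ln (s / h) + h - s) + ennreal (s * m + g)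
    = ennreal (s * ln (s / g) + g - s) + ennreal (s * (ln (g / h) + m) + h)"
    using assms m by (subst (1 2) ennreal_plus[symmetric]) (auto simp: algebra_simps)
  then show ?thesis
    using assms by (simp add: kl_excess_def m(2) flip: m_def)
qed

text \<open>Integrating the three-point identity replaces \<open>s\<close> by its mean \<open>g\<close> in the terms that are affine in \<open>s\<close>. The
two averages then differ by the total mass times the excess of \<open>g\<close> over \<open>h\<close>, which is nonnegative. The
argument only adds, so it also covers an infinite right-hand side. When \<open>h = 0\<close>, the right-hand side is
infinite.\<close>
lemma kl_excess_mean_le:
  fixes s :: "'a \<Rightarrow> real"
  assumes "finite_measure \<mu>" and mass: "measure \<mu> (space \<mu>) > 0"
    and int: "integrable \<mu> s" and s: "\<And>\<theta>. 0 < s \<theta>" and h: "0 \<le> h"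
    and g: "g = (\<integral>\<theta>. s \<theta> \<partial>\<mu>) / measure \<mu> (space \<mu>)" "0 < g"
  shows "(\<integral>\<^sup>+\<theta>. kl_excess (s \<theta>) g \<partial>\<mu>) \<le> (\<integral>\<^sup>+\<theta>. kl_excess (s \<theta>) h \<partial>\<mu>)"
proof (cases "h = 0")
  case True
  interpret finite_measure \<mu> by fact
  have "(\<integral>\<^sup>+\<theta>. kl_excess (s \<theta>) h \<partial>\<mu>) = (\<integral>\<^sup>+\<theta>. \<infinity> \<partial>\<mu>)"
    using s True by (intro nn_integral_cong) (simp add: kl_excess_def less_imp_neq[THEN not_sym])
  also have "\<dots> = \<infinity>"
    using mass by (simp add: emeasure_eq_measure ennreal_top_mult)
  finally show ?thesis by simp
next
  case False
  interpret finite_measure \<mu> by fact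
  have h: "h > 0" using h False by simp
  let ?m = "measure \<mu> (space \<mu>)" and ?l = "ln (g / h)"
  have [measurable]: "s \<in> borel_measurable \<mu>"
    using int by simp
  have affine: "(\<integral>\<^sup>+\<theta>. ennreal (s \<theta> * a + b) \<partial>\<mu>) = ennreal (?m * (g * a + b))" if "0 \<le> a" "0 \<le> b" for a b
  proof -
    have "(\<integral>\<^sup>+\<theta>. ennreal (s \<theta> * a + b) \<partial>\<mu>) = ennreal (\<integral>\<theta>. s \<theta> * a + b \<partial>\<mu>)"
      using int s that by (intro nn_integral_eq_integral) (auto simp: less_imp_le)
    also have "(\<integral>\<theta>. s \<theta> * a + b \<partial>\<mu>) = ?m * (g * a + b)"
      using int mass g(1) by (simp add: field_simps)
    finally show ?thesis .
  qed
  have split: "(\<integral>\<^sup>+\<theta>. kl_excess (s \<theta>) h \<partial>\<mu>) + ennreal (?m * (g * max 0 (- ?l) + g))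
    = (\<integral>\<^sup>+\<theta>. kl_excess (s \<theta>) g \<partial>\<mu>) + ennreal (?m * (g * max 0 ?l + h))"
  proof -
    have "(\<integral>\<^sup>+\<theta>. kl_excess (s \<theta>) h + ennreal (s \<theta> * max 0 (- ?l) + g) \<partial>\<mu>)
      = (\<integral>\<^sup>+\<theta>. kl_excess (s \<theta>) g + ennreal (s \<theta> * max 0 ?l + h) \<partial>\<mu>)"
      by (intro nn_integral_cong kl_excess_three_point s g h)
    then show ?thesis
      using g h by (simp add: nn_integral_add affine)
  qed
  have "g * max 0 (- ?l) + g \<le> g * max 0 ?l + h"
  proof -
    have "g - h \<le> g * ?l"
      using mult_ln_ge_diff[of g h] g h by simp
    moreover have "g * max 0 ?l = g * ?l + g * max 0 (- ?l)"
      by (auto simp: max_def)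
    ultimately show ?thesis by simp
  qed
  then have "ennreal (?m * (g * max 0 (- ?l) + g)) \<le> ennreal (?m * (g * max 0 ?l + h))"
    using mass by (intro ennreal_leI mult_left_mono) simp_all
  then have "(\<integral>\<^sup>+\<theta>. kl_excess (s \<theta>) g \<partial>\<mu>) + ennreal (?m * (g * max 0 (- ?l) + g))
     \<le> (\<integral>\<^sup>+\<theta>. kl_excess (s \<theta>) h \<partial>\<mu>) + ennreal (?m * (g * max 0 (- ?l) + g))"
    unfolding split by (rule add_left_mono)
  then show ?thesis
    by (rule ennreal_add_right_cancel_le) simp
qed

section \<open>Location models: best equivariant and minimax prediction\<close>

lemma integral_lborel_affine:
  fixes F :: "'a::euclidean_space \<Rightarrow> real"
  assumes [measurable]: "F \<in> borel_measurable borel" and t: "t \<noteq> 0"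
  shows "(\<integral>\<sigma>. F \<sigma> \<partial>lborel) = \<bar>t\<bar> ^ DIM('a) * (\<integral>u. F (s + t *\<^sub>R u) \<partial>lborel)"
proof -
  have "(\<integral>\<sigma>. F \<sigma> \<partial>lborel) = (\<integral>\<sigma>. F \<sigma> \<partial>density (distr lborel borel (\<lambda>x. s + t *\<^sub>R x)) (\<lambda>_. ennreal (\<bar>t\<bar>^DIM('a))))"
    using lborel_affine[OF t, of s] by simp
  also have "\<dots> = \<bar>t\<bar> ^ DIM('a) * (\<integral>u. F (s + t *\<^sub>R u) \<partial>lborel)"
    by (subst integral_density) (simp_all add: integral_distr)
  finally show ?thesis .
qed

lemma integral_lborel_pos:
  fixes F :: "'a::euclidean_space \<Rightarrow> real"
  assumes F: "integrable lborel F" and pos: "\<And>x. F x > 0"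
  shows "(\<integral>x. F x \<partial>lborel) > 0"
proof -
  have "(\<integral>x. F x \<partial>lborel) \<noteq> 0"
  proof
    assume "(\<integral>x. F x \<partial>lborel) = 0"
    then have "AE x in lborel. F x = 0"
      using integral_nonneg_eq_0_iff_AE[OF F] pos by (simp add: less_imp_le)
    then have "AE x in (lborel :: 'a measure). False"
      by (rule eventually_mono) (use pos in \<open>simp add: less_imp_neq[THEN not_sym]\<close>)
    then show False
      by (simp only: eventually_False ae_filter_eq_bot_iff) simp
  qed
  moreover have "(\<integral>x. F x \<partial>lborel) \<ge> 0"
    using pos by (simp add: less_imp_le)
  ultimately show ?thesis by simp
qed

text \<open>Besides being the density of the observation, \<open>f1\<close> serves in the minimax argument as the density of the
prior. Its continuity and boundedness make the posterior means converge there.\<close>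
locale location_model =
  fixes f1 f2 :: "real^'d \<Rightarrow> real" and B1 B2 :: real
  assumes cont1: "continuous_on UNIV f1" and cont2: "continuous_on UNIV f2"
    and pos1: "\<And>x. 0 < f1 x" and pos2: "\<And>x. 0 < f2 x"
    and bound1: "\<And>x. f1 x \<le> B1" and bound2: "\<And>x. f2 x \<le> B2"
    and mass1: "(\<integral>\<^sup>+x. ennreal (f1 x) \<partial>lborel) = 1" and mass2: "(\<integral>\<^sup>+x. ennreal (f2 x) \<partial>lborel) = 1"
begin

lemma measurable1 [measurable]: "f1 \<in> borel_measurable borel"
  and measurable2 [measurable]: "f2 \<in> borel_measurable borel"
  using cont1 cont2 by (auto intro: borel_measurable_continuous_onI)

lemmas nonneg [simp] = pos1[THEN less_imp_le] pos2[THEN less_imp_le]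

lemma integrable1: "integrable lborel f1"
  using mass1 by (simp add: integrable_iff_bounded)

lemma integrable1_reflect: "integrable lborel (\<lambda>u. f1 (x - u))"
  and integral1_reflect: "(\<integral>u. f1 (x - u) \<partial>lborel) = 1"
proof -
  have *: "(\<integral>\<^sup>+u. ennreal (f1 (x - u)) \<partial>lborel) = 1"
    using nn_integral_lborel_reflect[of "\<lambda>u. ennreal (f1 u)" x] by (simp add: mass1)
  then show "integrable lborel (\<lambda>u. f1 (x - u))"
    by (simp add: integrable_iff_bounded)
  show "(\<integral>u. f1 (x - u) \<partial>lborel) = 1"
    using * by (subst integral_eq_nn_integral) simp_all
qed

lemma abs_le_bounds [simp]: "\<bar>f1 x\<bar> \<le> B1" "\<bar>f2 x\<bar> \<le> B2" "0 \<le> B1" "0 \<le> B2"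
  using bound1[of x] bound2[of x] pos1[of x] pos2[of x] by simp_all

text \<open>The density of \<open>Y - X\<close> for independent \<open>X\<close> and \<open>Y\<close>, which does not depend on the location parameter.\<close>
definition diff_density :: "real^'d \<Rightarrow> real" where
  "diff_density w = (\<integral>u. f2 (w + u) * f1 u \<partial>lborel)"

lemma integrable_diff: "integrable lborel (\<lambda>u. f2 (w + u) * f1 u)"
  by (rule Bochner_Integration.integrable_bound[OF integrable_mult_right[OF integrable1, of B2]])
    (auto simp: abs_mult bound2 intro!: AE_I2 mult_right_mono)

lemma diff_density_pos: "0 < diff_density w"
  unfolding diff_density_def by (rule integral_lborel_pos[OF integrable_diff]) (simp add: pos1 pos2)

lemma measurable_diff_density [measurable]: "diff_density \<in> borel_measurable borel"
  unfolding diff_density_def by measurable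

lemma ennreal_diff_density: "ennreal (diff_density w) = (\<integral>\<^sup>+u. ennreal (f2 (w + u)) * ennreal (f1 u) \<partial>lborel)"
  unfolding diff_density_def
  by (subst nn_integral_eq_integral[symmetric, OF integrable_diff]) (auto simp: ennreal_mult)

text \<open>The substitution \<open>\<theta> = x - u\<close>.\<close>
lemma integral_location_product: "(\<integral>\<theta>. f2 (y - \<theta>) * f1 (x - \<theta>) \<partial>lborel) = diff_density (y - x)"
  using integral_lborel_affine[of "\<lambda>\<theta>. f2 (y - \<theta>) * f1 (x - \<theta>)" "- 1" x]
  by (simp add: diff_density_def algebra_simps)

lemma mass_diff_density: "(\<integral>\<^sup>+w. ennreal (diff_density w) \<partial>lborel) = 1"
proof -
  have "(\<integral>\<^sup>+w. ennreal (diff_density w) \<partial>lborel) = (\<integral>\<^sup>+u. (\<integral>\<^sup>+w. ennreal (f2 (w + u)) * ennreal (f1 u) \<partial>lborel) \<partial>lborel)"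
    unfolding ennreal_diff_density by (rule lborel_pair.Fubini') measurable
  also have "\<dots> = (\<integral>\<^sup>+u. ennreal (f1 u) \<partial>lborel)"
  proof (rule nn_integral_cong)
    fix u
    show "(\<integral>\<^sup>+w. ennreal (f2 (w + u)) * ennreal (f1 u) \<partial>lborel) = ennreal (f1 u)"
      using nn_integral_lborel_translate[of "\<lambda>w. ennreal (f2 w)" u]
      by (simp add: nn_integral_multc mass2 add.commute)
  qed
  finally show ?thesis by (simp add: mass1)
qed

lemma pred_density_diff: "pred_density (\<lambda>y x. diff_density (y - x))"
proof -
  have "(\<integral>\<^sup>+y. ennreal (diff_density (y - x)) \<partial>lborel) = 1" for x
    using nn_integral_lborel_translate[of "\<lambda>w. ennreal (diff_density w)" "- x"] by (simp add: mass_diff_density)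
  then show ?thesis
    by (simp add: pred_density_def diff_density_pos less_imp_le)
qed

definition risk :: "real^'d \<Rightarrow> (real^'d \<Rightarrow> real^'d \<Rightarrow> real) \<Rightarrow> ennreal" where
  "risk \<theta> r = (\<integral>\<^sup>+x. (\<integral>\<^sup>+y. ennreal (f1 (x - \<theta>)) * kl_excess (f2 (y - \<theta>)) (r y x) \<partial>lborel) \<partial>lborel)"

lemma KL_risk_eq:
  assumes r: "pred_density r"
  shows "KL_risk (\<lambda>\<theta> x. f1 (x - \<theta>)) (\<lambda>\<theta> y. f2 (y - \<theta>)) \<theta> r = enn2ereal (risk \<theta> r)"
proof -
  have [measurable]: "(\<lambda>(y, x). r y x) \<in> borel_measurable (borel \<Otimes>\<^sub>M borel)"
    using r by (auto simp: pred_density_def)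
  have "(\<integral>\<^sup>+y. ennreal (f2 (y - \<theta>)) \<partial>lborel) = 1"
    using nn_integral_lborel_translate[of "\<lambda>w. ennreal (f2 w)" "- \<theta>"] by (simp add: mass2)
  then show ?thesis
    unfolding risk_def
    by (subst KL_risk_eq_nn_integral[OF r]) (simp_all add: nn_integral_cmult mult.commute)
qed

lemma risk_translate:
  assumes [measurable]: "(\<lambda>(y, x). r y x) \<in> borel_measurable (borel \<Otimes>\<^sub>M borel)"
  shows "risk \<theta> r = (\<integral>\<^sup>+x. (\<integral>\<^sup>+y. ennreal (f1 x) * kl_excess (f2 y) (r (\<theta> + y) (\<theta> + x)) \<partial>lborel) \<partial>lborel)"
proof -
  have "risk \<theta> r = (\<integral>\<^sup>+x. (\<integral>\<^sup>+y. ennreal (f1 (\<theta> + x - \<theta>)) * kl_excess (f2 (y - \<theta>)) (r y (\<theta> + x)) \<partial>lborel) \<partial>lborel)"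
    unfolding risk_def by (rule nn_integral_lborel_translate[symmetric]) measurable
  also have "\<dots> = (\<integral>\<^sup>+x. (\<integral>\<^sup>+y. ennreal (f1 (\<theta> + x - \<theta>)) * kl_excess (f2 (\<theta> + y - \<theta>)) (r (\<theta> + y) (\<theta> + x)) \<partial>lborel) \<partial>lborel)"
    by (intro nn_integral_cong nn_integral_lborel_translate[symmetric]) measurable
  finally show ?thesis by simp
qed

text \<open>An equivariant estimator satisfies \<open>r y x = r (y - x) 0\<close>. After shifting \<open>\<theta>\<close> away and substituting
\<open>y = w + u\<close>, the dependence on the estimator is through \<open>w\<close> only.\<close>
lemma risk_equivariant:
  assumes r: "equivariant r" and [measurable]: "(\<lambda>(y, x). r y x) \<in> borel_measurable (borel \<Otimes>\<^sub>M borel)"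
  shows "risk \<theta> r = (\<integral>\<^sup>+w. (\<integral>\<^sup>+u. ennreal (f1 u) * kl_excess (f2 (w + u)) (r w 0) \<partial>lborel) \<partial>lborel)"
proof -
  have r0: "r (\<theta> + (u + w)) (\<theta> + u) = r w 0" for w u
    using r unfolding equivariant_def by (metis add.commute add.left_commute add_0)
  have "risk \<theta> r = (\<integral>\<^sup>+u. (\<integral>\<^sup>+w. ennreal (f1 u) * kl_excess (f2 (u + w)) (r (\<theta> + (u + w)) (\<theta> + u)) \<partial>lborel) \<partial>lborel)"
    unfolding risk_translate[OF assms(2)]
    by (intro nn_integral_cong nn_integral_lborel_translate[symmetric]) measurable
  also have "\<dots> = (\<integral>\<^sup>+u. (\<integral>\<^sup>+w. ennreal (f1 u) * kl_excess (f2 (w + u)) (r w 0) \<partial>lborel) \<partial>lborel)"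
    unfolding r0 by (simp add: add.commute)
  also have "\<dots> = (\<integral>\<^sup>+w. (\<integral>\<^sup>+u. ennreal (f1 u) * kl_excess (f2 (w + u)) (r w 0) \<partial>lborel) \<partial>lborel)"
    by (rule lborel_pair.Fubini') measurable
  finally show ?thesis .
qed

lemma equivariant_diff: "equivariant (\<lambda>y x. diff_density (y - x))"
  by (simp add: equivariant_def)

text \<open>For fixed \<open>w\<close>, the value \<open>diff_density w\<close> is the mean of \<open>f2 (w + u)\<close> when \<open>u\<close> has density \<open>f1\<close>.\<close>
lemma diff_density_minimizes_equivariant_risk:
  assumes r: "pred_density r" "equivariant r"
  shows "risk \<theta> (\<lambda>y x. diff_density (y - x)) \<le> risk \<theta> r"
proof -
  have [measurable]: "(\<lambda>(y, x). r y x) \<in> borel_measurable (borel \<Otimes>\<^sub>M borel)" and r0: "\<And>y x. 0 \<le> r y x"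
    using r by (auto simp: pred_density_def)
  let ?\<mu> = "density lborel (\<lambda>u. ennreal (f1 u))"
  interpret prob_space ?\<mu>
    by rule (simp add: emeasure_density mass1)
  have "(\<integral>\<^sup>+u. ennreal (f1 u) * kl_excess (f2 (w + u)) (diff_density w) \<partial>lborel)
    \<le> (\<integral>\<^sup>+u. ennreal (f1 u) * kl_excess (f2 (w + u)) (r w 0) \<partial>lborel)" for w
  proof -
    have "(\<integral>\<^sup>+u. kl_excess (f2 (w + u)) (diff_density w) \<partial>?\<mu>) \<le> (\<integral>\<^sup>+u. kl_excess (f2 (w + u)) (r w 0) \<partial>?\<mu>)"
    proof (rule kl_excess_mean_le)
      show "finite_measure ?\<mu>"
        by (rule finite_measure_axioms)
      show "measure ?\<mu> (space ?\<mu>) > 0"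
        by (simp only: prob_space)
      show "integrable ?\<mu> (\<lambda>u. f2 (w + u))"
        using integrable_diff[of w] by (subst integrable_real_density) (auto simp: mult.commute)
      show "diff_density w = (\<integral>u. f2 (w + u) \<partial>?\<mu>) / measure ?\<mu> (space ?\<mu>)"
        by (subst prob_space) (simp add: integral_density diff_density_def mult.commute)
    qed (simp_all add: pos2 r0 diff_density_pos)
    then show ?thesis
      by (simp add: nn_integral_density)
  qed
  then show ?thesis
    by (simp add: risk_equivariant[OF equivariant_diff] risk_equivariant[OF r(2)] nn_integral_mono)
qed

lemma integrable_posterior_weight: "integrable lborel (\<lambda>\<tau>. f1 (x - c *\<^sub>R \<tau>) * f1 \<tau>)"
  by (rule Bochner_Integration.integrable_bound[OF integrable_mult_right[OF integrable1, of B1]])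
    (auto simp: abs_mult bound1 intro!: AE_I2 mult_right_mono)

lemma integrable_posterior_numerator: "integrable lborel (\<lambda>\<tau>. f2 (y - c *\<^sub>R \<tau>) * (f1 (x - c *\<^sub>R \<tau>) * f1 \<tau>))"
  by (rule Bochner_Integration.integrable_bound[OF integrable_mult_right[OF integrable_posterior_weight, of B2]])
    (auto simp: abs_mult bound2 intro!: AE_I2 mult_right_mono)

text \<open>The predictive density for the proper prior under which \<open>\<theta> = c \<tau>\<close> and \<open>\<tau>\<close> has density \<open>f1\<close>.\<close>
definition posterior_mean :: "real \<Rightarrow> real^'d \<Rightarrow> real^'d \<Rightarrow> real" where
  "posterior_mean c y x = (\<integral>\<tau>. f2 (y - c *\<^sub>R \<tau>) * (f1 (x - c *\<^sub>R \<tau>) * f1 \<tau>) \<partial>lborel)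
     / (\<integral>\<tau>. f1 (x - c *\<^sub>R \<tau>) * f1 \<tau> \<partial>lborel)"

lemma measurable_posterior_mean: 
  "(\<lambda>(y, x). posterior_mean c y x) \<in> borel_measurable (borel \<Otimes>\<^sub>M borel)"
  unfolding posterior_mean_def by measurable

lemma posterior_mean_pos: "0 < posterior_mean c y x"
  unfolding posterior_mean_def
  by (intro divide_pos_pos integral_lborel_pos integrable_posterior_weight integrable_posterior_numerator) (simp_all add: pos1 pos2)

lemma bayes_risk_eq:
  assumes [measurable]: "(\<lambda>(y, x). r y x) \<in> borel_measurable (borel \<Otimes>\<^sub>M borel)"
  shows "(\<integral>\<^sup>+\<tau>. ennreal (f1 \<tau>) * risk (c *\<^sub>R \<tau>) r \<partial>lborel)
    = (\<integral>\<^sup>+x. (\<integral>\<^sup>+y. (\<integral>\<^sup>+\<tau>. ennreal (f1 (x - c *\<^sub>R \<tau>) * f1 \<tau>) * kl_excess (f2 (y - c *\<^sub>R \<tau>)) (r y x) \<partial>lborel) \<partial>lborel) \<partial>lborel)"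
proof -
  let ?F = "\<lambda>\<tau> x y. ennreal (f1 (x - c *\<^sub>R \<tau>) * f1 \<tau>) * kl_excess (f2 (y - c *\<^sub>R \<tau>)) (r y x)"
  have "(\<integral>\<^sup>+\<tau>. ennreal (f1 \<tau>) * risk (c *\<^sub>R \<tau>) r \<partial>lborel) = (\<integral>\<^sup>+\<tau>. (\<integral>\<^sup>+x. (\<integral>\<^sup>+y. ?F \<tau> x y \<partial>lborel) \<partial>lborel) \<partial>lborel)"
    unfolding risk_def by (simp add: ennreal_mult nn_integral_cmult[symmetric] mult_ac)
  also have "\<dots> = (\<integral>\<^sup>+x. (\<integral>\<^sup>+\<tau>. (\<integral>\<^sup>+y. ?F \<tau> x y \<partial>lborel) \<partial>lborel) \<partial>lborel)"
    by (rule lborel_pair.Fubini') measurable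
  also have "\<dots> = (\<integral>\<^sup>+x. (\<integral>\<^sup>+y. (\<integral>\<^sup>+\<tau>. ?F \<tau> x y \<partial>lborel) \<partial>lborel) \<partial>lborel)"
    by (rule nn_integral_cong, rule lborel_pair.Fubini') measurable
  finally show ?thesis .
qed

text \<open>For fixed \<open>x\<close> and \<open>y\<close>, the average over \<open>\<tau>\<close> is taken with respect to the unnormalised posterior, and
\<open>posterior_mean c y x\<close> is the mean of \<open>f2 (y - c \<tau>)\<close> under it.\<close>
lemma posterior_mean_minimizes_bayes_risk:
  assumes r: "pred_density r"
  shows "(\<integral>\<^sup>+\<tau>. ennreal (f1 \<tau>) * risk (c *\<^sub>R \<tau>) (posterior_mean c) \<partial>lborel)
    \<le> (\<integral>\<^sup>+\<tau>. ennreal (f1 \<tau>) * risk (c *\<^sub>R \<tau>) r \<partial>lborel)"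
proof -
  have r_meas [measurable]: "(\<lambda>(y, x). r y x) \<in> borel_measurable (borel \<Otimes>\<^sub>M borel)" and r0: "\<And>y x. 0 \<le> r y x"
    using r by (auto simp: pred_density_def)
  have le: "(\<integral>\<^sup>+\<tau>. ennreal (f1 (x - c *\<^sub>R \<tau>) * f1 \<tau>) * kl_excess (f2 (y - c *\<^sub>R \<tau>)) (posterior_mean c y x) \<partial>lborel)
    \<le> (\<integral>\<^sup>+\<tau>. ennreal (f1 (x - c *\<^sub>R \<tau>) * f1 \<tau>) * kl_excess (f2 (y - c *\<^sub>R \<tau>)) (r y x) \<partial>lborel)" for x y
  proof -
    let ?\<mu> = "density lborel (\<lambda>\<tau>. ennreal (f1 (x - c *\<^sub>R \<tau>) * f1 \<tau>))"
    have em: "emeasure ?\<mu> (space ?\<mu>) = ennreal (\<integral>\<tau>. f1 (x - c *\<^sub>R \<tau>) * f1 \<tau> \<partial>lborel)"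
      by (simp add: emeasure_density nn_integral_eq_integral[OF integrable_posterior_weight])
    then have m: "measure ?\<mu> (space ?\<mu>) = (\<integral>\<tau>. f1 (x - c *\<^sub>R \<tau>) * f1 \<tau> \<partial>lborel)"
      by (simp add: measure_def)
    have "(\<integral>\<^sup>+\<tau>. kl_excess (f2 (y - c *\<^sub>R \<tau>)) (posterior_mean c y x) \<partial>?\<mu>)
      \<le> (\<integral>\<^sup>+\<tau>. kl_excess (f2 (y - c *\<^sub>R \<tau>)) (r y x) \<partial>?\<mu>)"
    proof (rule kl_excess_mean_le)
      show "finite_measure ?\<mu>"
        by (rule finite_measureI, unfold em) simp
      show "measure ?\<mu> (space ?\<mu>) > 0"
        unfolding m by (intro integral_lborel_pos integrable_posterior_weight) (simp add: pos1)
      show "integrable ?\<mu> (\<lambda>\<tau>. f2 (y - c *\<^sub>R \<tau>))"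
        using integrable_posterior_numerator[of y c x] by (subst integrable_real_density) (auto simp: mult_ac)
      show "posterior_mean c y x = (\<integral>\<tau>. f2 (y - c *\<^sub>R \<tau>) \<partial>?\<mu>) / measure ?\<mu> (space ?\<mu>)"
        unfolding m by (subst integral_density) (simp_all add: posterior_mean_def mult_ac)
    qed (simp_all add: pos2 r0 posterior_mean_pos)
    then show ?thesis
      by (simp add: nn_integral_density)
  qed
  show ?thesis
    unfolding bayes_risk_eq[OF measurable_posterior_mean] bayes_risk_eq[OF r_meas]
    by (rule nn_integral_mono, rule nn_integral_mono, rule le)
qed

text \<open>The substitution \<open>\<sigma> = \<tau> + u / c\<close> puts the scale into the argument of the prior density only. The Jacobians
of numerator and denominator cancel.\<close>
lemma posterior_mean_rescale:
  assumes c: "c > 0"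
  shows "posterior_mean c (c *\<^sub>R \<tau> + y) (c *\<^sub>R \<tau> + x)
    = (\<integral>u. f2 (y - u) * f1 (x - u) * f1 (\<tau> + (1 / c) *\<^sub>R u) \<partial>lborel) / (\<integral>u. f1 (x - u) * f1 (\<tau> + (1 / c) *\<^sub>R u) \<partial>lborel)"
proof -
  have arg: "c *\<^sub>R \<tau> + z - c *\<^sub>R (\<tau> + (1 / c) *\<^sub>R u) = z - u" for z u
    using c by (simp add: algebra_simps)
  have "(\<integral>\<sigma>. f2 (c *\<^sub>R \<tau> + y - c *\<^sub>R \<sigma>) * (f1 (c *\<^sub>R \<tau> + x - c *\<^sub>R \<sigma>) * f1 \<sigma>) \<partial>lborel)
    = \<bar>1 / c\<bar> ^ DIM(real^'d) * (\<integral>u. f2 (y - u) * (f1 (x - u) * f1 (\<tau> + (1 / c) *\<^sub>R u)) \<partial>lborel)"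
    by (subst integral_lborel_affine[where t = "1 / c" and s = \<tau>]) (use c in \<open>simp_all only: arg, simp_all\<close>)
  moreover have "(\<integral>\<sigma>. f1 (c *\<^sub>R \<tau> + x - c *\<^sub>R \<sigma>) * f1 \<sigma> \<partial>lborel)
    = \<bar>1 / c\<bar> ^ DIM(real^'d) * (\<integral>u. f1 (x - u) * f1 (\<tau> + (1 / c) *\<^sub>R u) \<partial>lborel)"
    by (subst integral_lborel_affine[where t = "1 / c" and s = \<tau>]) (use c in \<open>simp_all only: arg, simp_all\<close>)
  ultimately show ?thesis
    using c by (simp add: posterior_mean_def mult.assoc)
qed

text \<open>By continuity of the prior density \<open>f1 (\<tau> + u / c)\<close> tends to the constant \<open>f1 \<tau>\<close>, which cancels in
the quotient. Boundedness of \<open>f1\<close> gives dominated convergence.\<close>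
lemma posterior_mean_tendsto:
  "(\<lambda>n. posterior_mean (real (Suc n)) (real (Suc n) *\<^sub>R \<tau> + y) (real (Suc n) *\<^sub>R \<tau> + x)) \<longlonglongrightarrow> diff_density (y - x)"
proof -
  have "(\<lambda>n. 1 / real (Suc n)) \<longlonglongrightarrow> 0"
    using LIMSEQ_inverse_real_of_nat by (simp add: inverse_eq_divide)
  then have "(\<lambda>n. \<tau> + (1 / real (Suc n)) *\<^sub>R u) \<longlonglongrightarrow> \<tau> + 0 *\<^sub>R u" for u
    by (intro tendsto_intros)
  then have lim: "(\<lambda>n. f1 (\<tau> + (1 / real (Suc n)) *\<^sub>R u)) \<longlonglongrightarrow> f1 \<tau>" for u
    using continuous_on_tendsto_compose[OF cont1, of "\<lambda>n. \<tau> + (1 / real (Suc n)) *\<^sub>R u" \<tau>] by simp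
  have dct: "(\<lambda>n. \<integral>u. h u * f1 (\<tau> + (1 / real (Suc n)) *\<^sub>R u) \<partial>lborel) \<longlonglongrightarrow> (\<integral>u. h u * f1 \<tau> \<partial>lborel)"
    if h: "integrable lborel h" for h :: "real^'d \<Rightarrow> real"
  proof (rule integral_dominated_convergence[where w = "\<lambda>u. \<bar>h u\<bar> * B1"])
    have [measurable]: "h \<in> borel_measurable borel"
      using h by simp
    show "(\<lambda>u. h u * f1 \<tau>) \<in> borel_measurable lborel" "(\<lambda>u. h u * f1 (\<tau> + (1 / real (Suc n)) *\<^sub>R u)) \<in> borel_measurable lborel" for n
      by measurable
    show "integrable lborel (\<lambda>u. \<bar>h u\<bar> * B1)"
      using h by simp
    show "AE u in lborel. (\<lambda>n. h u * f1 (\<tau> + (1 / real (Suc n)) *\<^sub>R u)) \<longlonglongrightarrow> h u * f1 \<tau>"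
      by (intro AE_I2 tendsto_intros lim)
    show "AE u in lborel. norm (h u * f1 (\<tau> + (1 / real (Suc n)) *\<^sub>R u)) \<le> \<bar>h u\<bar> * B1" for n
      by (auto simp: abs_mult bound1 intro!: AE_I2 mult_left_mono)
  qed
  have i2: "integrable lborel (\<lambda>u. f2 (y - u) * f1 (x - u))"
    by (rule Bochner_Integration.integrable_bound[OF integrable_mult_right[OF integrable1_reflect, of B2]])
      (auto simp: abs_mult bound2 intro!: AE_I2 mult_right_mono)
  have "(\<lambda>n. (\<integral>u. f2 (y - u) * f1 (x - u) * f1 (\<tau> + (1 / real (Suc n)) *\<^sub>R u) \<partial>lborel)
      / (\<integral>u. f1 (x - u) * f1 (\<tau> + (1 / real (Suc n)) *\<^sub>R u) \<partial>lborel))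
    \<longlonglongrightarrow> (\<integral>u. f2 (y - u) * f1 (x - u) * f1 \<tau> \<partial>lborel) / (\<integral>u. f1 (x - u) * f1 \<tau> \<partial>lborel)"
    using pos1[of \<tau>] by (intro tendsto_divide dct i2 integrable1_reflect) (simp add: integral1_reflect)
  also have "(\<integral>u. f2 (y - u) * f1 (x - u) * f1 \<tau> \<partial>lborel) / (\<integral>u. f1 (x - u) * f1 \<tau> \<partial>lborel) = diff_density (y - x)"
    using pos1[of \<tau>] by (simp add: integral1_reflect integral_location_product)
  finally show ?thesis
    by (simp add: posterior_mean_rescale)
qed

lemma kl_excess_tendsto:
  assumes g: "(\<lambda>n. g n) \<longlonglongrightarrow> l" "0 < l" "\<And>n. 0 < g n" and s: "0 < s"
  shows "(\<lambda>n. kl_excess s (g n)) \<longlonglongrightarrow> kl_excess s l"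
proof -
  have "(\<lambda>n. ennreal (s * ln (s / g n) + g n - s)) \<longlonglongrightarrow> ennreal (s * ln (s / l) + l - s)"
    using g s by (intro tendsto_intros tendsto_ennrealI) auto
  moreover have "g n \<noteq> 0" for n
    using g(3)[of n] by simp
  ultimately show ?thesis
    using g(2) by (simp add: kl_excess_def)
qed

text \<open>Fatou's lemma for the three integrals over \<open>\<tau>\<close>, \<open>x\<close> and \<open>y\<close>, with \<open>x\<close> and \<open>y\<close> measured from
the parameter \<open>c \<tau>\<close>. The limit integrand gives the risk of \<open>diff_density (y - x)\<close>, which is the same for every parameter.\<close>
lemma risk_diff_density_le_liminf:
  "risk \<theta> (\<lambda>y x. diff_density (y - x))
    \<le> liminf (\<lambda>n. \<integral>\<^sup>+\<tau>. ennreal (f1 \<tau>) * risk (real (Suc n) *\<^sub>R \<tau>) (posterior_mean (real (Suc n))) \<partial>lborel)"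
proof -
  define h where "h n \<tau> x y = ennreal (f1 \<tau>) * (ennreal (f1 x) * kl_excess (f2 y)
    (posterior_mean (real (Suc n)) (real (Suc n) *\<^sub>R \<tau> + y) (real (Suc n) *\<^sub>R \<tau> + x)))" for n \<tau> x y
  note measurable_posterior_mean [measurable]
  have h_meas [measurable (raw)]: "(\<lambda>z. h n (t z) (f z) (g z)) \<in> borel_measurable N"
    if [measurable]: "t \<in> borel_measurable N" "f \<in> borel_measurable N" "g \<in> borel_measurable N"
    for n t f g and N :: "'z measure"
    unfolding h_def by measurable
  have lim: "ennreal (f1 \<tau>) * (ennreal (f1 x) * kl_excess (f2 y) (diff_density (y - x))) = liminf (\<lambda>n. h n \<tau> x y)" for \<tau> x y
    unfolding h_def
    by (intro lim_imp_Liminf[symmetric] ennreal_tendsto_cmult kl_excess_tendsto posterior_mean_tendsto)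
      (auto simp: diff_density_pos posterior_mean_pos pos2)
  have "risk \<theta> (\<lambda>y x. diff_density (y - x)) = (\<integral>\<^sup>+\<tau>. ennreal (f1 \<tau>) * risk \<theta> (\<lambda>y x. diff_density (y - x)) \<partial>lborel)"
    by (simp add: nn_integral_multc mass1)
  also have "\<dots> = (\<integral>\<^sup>+\<tau>. (\<integral>\<^sup>+x. (\<integral>\<^sup>+y. liminf (\<lambda>n. h n \<tau> x y) \<partial>lborel) \<partial>lborel) \<partial>lborel)"
    by (subst risk_translate) (simp_all add: nn_integral_cmult flip: lim)
  also have "\<dots> \<le> (\<integral>\<^sup>+\<tau>. (\<integral>\<^sup>+x. liminf (\<lambda>n. \<integral>\<^sup>+y. h n \<tau> x y \<partial>lborel) \<partial>lborel) \<partial>lborel)"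
    by (intro nn_integral_mono nn_integral_liminf) measurable
  also have "\<dots> \<le> (\<integral>\<^sup>+\<tau>. liminf (\<lambda>n. \<integral>\<^sup>+x. (\<integral>\<^sup>+y. h n \<tau> x y \<partial>lborel) \<partial>lborel) \<partial>lborel)"
    by (intro nn_integral_mono nn_integral_liminf) measurable
  also have "\<dots> \<le> liminf (\<lambda>n. \<integral>\<^sup>+\<tau>. (\<integral>\<^sup>+x. (\<integral>\<^sup>+y. h n \<tau> x y \<partial>lborel) \<partial>lborel) \<partial>lborel)"
    by (intro nn_integral_liminf) measurable
  also have "(\<lambda>n. \<integral>\<^sup>+\<tau>. (\<integral>\<^sup>+x. (\<integral>\<^sup>+y. h n \<tau> x y \<partial>lborel) \<partial>lborel) \<partial>lborel)
    = (\<lambda>n. \<integral>\<^sup>+\<tau>. ennreal (f1 \<tau>) * risk (real (Suc n) *\<^sub>R \<tau>) (posterior_mean (real (Suc n))) \<partial>lborel)"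
    unfolding risk_translate[OF measurable_posterior_mean] h_def by (simp add: nn_integral_cmult)
  finally show ?thesis .
qed

text \<open>The supremum of the risk dominates its average over every prior, and each average is at least the Bayes
risk, attained by the posterior mean. The lower limit of these Bayes risks was bounded by Fatou's lemma.\<close>
lemma risk_diff_density_le_Sup:
  assumes r: "pred_density r"
  shows "risk \<theta> (\<lambda>y x. diff_density (y - x)) \<le> (SUP \<theta>. risk \<theta> r)"
proof -
  have "(\<integral>\<^sup>+\<tau>. ennreal (f1 \<tau>) * risk (real (Suc n) *\<^sub>R \<tau>) (posterior_mean (real (Suc n))) \<partial>lborel) \<le> (SUP \<theta>. risk \<theta> r)" for n
  proof -
    have "(\<integral>\<^sup>+\<tau>. ennreal (f1 \<tau>) * risk (real (Suc n) *\<^sub>R \<tau>) (posterior_mean (real (Suc n))) \<partial>lborel)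
      \<le> (\<integral>\<^sup>+\<tau>. ennreal (f1 \<tau>) * risk (real (Suc n) *\<^sub>R \<tau>) r \<partial>lborel)"
      by (rule posterior_mean_minimizes_bayes_risk[OF r])
    also have "\<dots> \<le> (\<integral>\<^sup>+\<tau>. ennreal (f1 \<tau>) * (SUP \<theta>. risk \<theta> r) \<partial>lborel)"
      by (intro nn_integral_mono mult_left_mono SUP_upper) auto
    also have "\<dots> = (SUP \<theta>. risk \<theta> r)"
      by (simp add: nn_integral_multc mass1)
    finally show ?thesis .
  qed
  then have "liminf (\<lambda>n. \<integral>\<^sup>+\<tau>. ennreal (f1 \<tau>) * risk (real (Suc n) *\<^sub>R \<tau>) (posterior_mean (real (Suc n))) \<partial>lborel)
    \<le> (SUP \<theta>. risk \<theta> r)"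
    by (intro Liminf_le) (auto intro: always_eventually)
  with risk_diff_density_le_liminf show ?thesis
    by (rule order_trans)
qed

lemma is_MRE_diff_density:
  "is_MRE (\<lambda>\<theta> x. f1 (x - \<theta>)) (\<lambda>\<theta> y. f2 (y - \<theta>)) (\<lambda>y x. diff_density (y - x))"
  unfolding is_MRE_def
  by (simp add: pred_density_diff equivariant_diff KL_risk_eq less_eq_ennreal.rep_eq[symmetric]
      diff_density_minimizes_equivariant_risk)

lemma is_minimax_diff_density:
  "is_minimax (\<lambda>\<theta> x. f1 (x - \<theta>)) (\<lambda>\<theta> y. f2 (y - \<theta>)) (\<lambda>y x. diff_density (y - x))"
  unfolding is_minimax_def
proof (intro conjI allI impI pred_density_diff)
  fix r :: "real^'d \<Rightarrow> real^'d \<Rightarrow> real" assume r: "pred_density r"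
  \<comment> \<open>The supremum is taken in the extended reals; it is nonnegative, so it can be moved to \<open>ennreal\<close> and back.\<close>
  let ?S = "SUP \<theta>. enn2ereal (risk \<theta> r)"
  have S: "enn2ereal (risk \<theta> r) \<le> ?S" for \<theta>
    by (rule SUP_upper) simp
  then have "risk \<theta> r \<le> e2ennreal ?S" for \<theta>
    by (metis e2ennreal_enn2ereal e2ennreal_mono)
  then have "risk \<theta> (\<lambda>y x. diff_density (y - x)) \<le> e2ennreal ?S" for \<theta>
    by (intro order_trans[OF risk_diff_density_le_Sup[OF r]] SUP_least)
  moreover have "0 \<le> ?S"
    using S[of 0] by (rule order_trans[OF enn2ereal_nonneg])
  ultimately have "enn2ereal (risk \<theta> (\<lambda>y x. diff_density (y - x))) \<le> ?S" for \<theta>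
    by (metis enn2ereal_e2ennreal less_eq_ennreal.rep_eq)
  then show "(SUP \<theta>. KL_risk (\<lambda>\<theta> x. f1 (x - \<theta>)) (\<lambda>\<theta> y. f2 (y - \<theta>)) \<theta> (\<lambda>y x. diff_density (y - x)))
    \<le> (SUP \<theta>. KL_risk (\<lambda>\<theta> x. f1 (x - \<theta>)) (\<lambda>\<theta> y. f2 (y - \<theta>)) \<theta> r)"
    by (simp add: KL_risk_eq[OF r] KL_risk_eq[OF pred_density_diff] SUP_least)
qed

lemma bayes_uniform_eq:
  "bayes_uniform (\<lambda>\<theta> x. f1 (x - \<theta>)) (\<lambda>\<theta> y. f2 (y - \<theta>)) = (\<lambda>y x. diff_density (y - x))"
  by (intro ext) (simp add: bayes_uniform_def integral_location_product integral1_reflect)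

end

section \<open>Mean mixtures of normal distributions\<close>

text \<open>For a probability measure \<open>\<mu>\<close> and positive definite \<open>S\<close>, this is the continuous density of the mean mixture with location zero
and mixing law \<open>\<mu>\<close>.\<close>
definition mixture_density :: "real measure \<Rightarrow> real^'d \<Rightarrow> real^'d^'d \<Rightarrow> real^'d \<Rightarrow> real" where
  "mixture_density \<mu> a S z = (\<integral>v. mvn_density (v *\<^sub>R a) S z \<partial>\<mu>)"

lemma emeasure_mvn:
  "B \<in> sets borel \<Longrightarrow> emeasure (mvn \<mu> S) B = (\<integral>\<^sup>+y. ennreal (mvn_density \<mu> S y) * indicator B y \<partial>lborel)"
  by (simp add: mvn_def emeasure_density)

context real_distribution
begin

lemma prob_UNIV: "prob UNIV = 1" and emeasure_UNIV_eq_1: "emeasure M UNIV = 1"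
  using prob_space emeasure_space_1 by simp_all

lemma pair_sigma_finite_lborel: "pair_sigma_finite M (lborel :: (real^'d) measure)"
  by unfold_locales

lemma integrable_mvn_density:
  "pos_def S \<Longrightarrow> integrable M (\<lambda>v. mvn_density (v *\<^sub>R a) S z)"
  by (rule integrable_const_bound[where B = "mvn_density 0 S 0"])
    (auto simp: mvn_density_le mvn_density_pos less_imp_le)

lemma ennreal_mixture_density:
  "pos_def S \<Longrightarrow> ennreal (mixture_density M a S z) = (\<integral>\<^sup>+v. ennreal (mvn_density (v *\<^sub>R a) S z) \<partial>M)"
  unfolding mixture_density_def
  by (subst nn_integral_eq_integral[OF integrable_mvn_density]) (auto simp: mvn_density_pos less_imp_le)

lemma mixture_density_pos:
  assumes "pos_def S" shows "0 < mixture_density M a S z"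
proof -
  have "0 \<noteq> (\<integral>v. mvn_density (v *\<^sub>R a) S z \<partial>M)"
  proof
    assume "0 = (\<integral>v. mvn_density (v *\<^sub>R a) S z \<partial>M)"
    then have "AE v in M. mvn_density (v *\<^sub>R a) S z = 0"
      using integral_nonneg_eq_0_iff_AE[OF integrable_mvn_density[OF assms]]
      by (simp add: mvn_density_pos[OF assms] less_imp_le)
    then have "AE v in M. False"
      by (rule eventually_mono) (metis less_irrefl mvn_density_pos[OF assms])
    then show False by simp
  qed
  moreover have "0 \<le> (\<integral>v. mvn_density (v *\<^sub>R a) S z \<partial>M)"
    by (intro integral_nonneg_AE AE_I2) (simp add: mvn_density_pos[OF assms] less_imp_le)
  ultimately show ?thesis
    by (simp add: mixture_density_def)
qed

lemma mixture_density_le: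
  assumes "pos_def S" shows "mixture_density M a S z \<le> mvn_density 0 S 0"
  unfolding mixture_density_def
  using integral_mono[OF integrable_mvn_density[OF assms, of a z] integrable_const[of "mvn_density 0 S 0"]]
  by (simp add: mvn_density_le[OF assms] prob_UNIV)

text \<open>Dominated convergence, with the maximal value of the normal density as the dominating constant.\<close>
lemma continuous_on_mixture_density:
  fixes a :: "real^'d"
  assumes S: "pos_def S" shows "continuous_on UNIV (mixture_density M a S)"
  unfolding continuous_on_sequentially
proof (intro allI ballI impI, elim conjE)
  fix z :: "nat \<Rightarrow> real^'d" and l assume z: "z \<longlonglongrightarrow> l"
  show "(mixture_density M a S \<circ> z) \<longlonglongrightarrow> mixture_density M a S l"
    unfolding mixture_density_def o_def
  proof (rule integral_dominated_convergence[where w = "\<lambda>_. mvn_density 0 S 0"])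
    show "AE v in M. (\<lambda>n. mvn_density (v *\<^sub>R a) S (z n)) \<longlonglongrightarrow> mvn_density (v *\<^sub>R a) S l"
      using continuous_on_tendsto_compose[OF continuous_on_mvn_density[OF S] z] by simp
    show "AE v in M. norm (mvn_density (v *\<^sub>R a) S (z n)) \<le> mvn_density 0 S 0" for n
      by (simp add: mvn_density_le[OF S] mvn_density_pos[OF S] less_imp_le)
  qed simp_all
qed

lemma measurable_mixture_density [measurable]: "mixture_density M a S \<in> borel_measurable borel"
  unfolding mixture_density_def by measurable

text \<open>Fubini identifies the mixture of the normal laws as the law with density \<open>mixture_density\<close>.\<close>
lemma nn_integral_emeasure_mvn:
  assumes S: "pos_def S" and [measurable]: "B \<in> sets borel"
  shows "(\<integral>\<^sup>+v. emeasure (mvn (\<theta> + v *\<^sub>R a) S) B \<partial>M)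
    = emeasure (density lborel (\<lambda>y. ennreal (mixture_density M a S (y - \<theta>)))) B"
proof -
  interpret L: pair_sigma_finite M "lborel :: (real^'a) measure"
    by (rule pair_sigma_finite_lborel)
  have "(\<integral>\<^sup>+v. emeasure (mvn (\<theta> + v *\<^sub>R a) S) B \<partial>M)
    = (\<integral>\<^sup>+v. (\<integral>\<^sup>+y. ennreal (mvn_density (v *\<^sub>R a) S (y - \<theta>)) * indicator B y \<partial>lborel) \<partial>M)"
    by (simp add: emeasure_mvn mvn_density_translate)
  also have "\<dots> = (\<integral>\<^sup>+y. (\<integral>\<^sup>+v. ennreal (mvn_density (v *\<^sub>R a) S (y - \<theta>)) * indicator B y \<partial>M) \<partial>lborel)"
    by (rule L.Fubini'[symmetric]) measurable
  also have "\<dots> = (\<integral>\<^sup>+y. ennreal (mixture_density M a S (y - \<theta>)) * indicator B y \<partial>lborel)"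
    by (intro nn_integral_cong) (simp add: nn_integral_multc ennreal_mixture_density[OF S])
  finally show ?thesis
    by (simp add: emeasure_density)
qed

lemma mass_mixture_density:
  assumes S: "pos_def S"
  shows "(\<integral>\<^sup>+z. ennreal (mixture_density M a S z) \<partial>lborel) = 1"
proof -
  have "emeasure (mvn (0 + v *\<^sub>R a) S) UNIV = 1" for v
    by (simp add: emeasure_mvn nn_integral_mvn_density[OF S])
  then show ?thesis
    using nn_integral_emeasure_mvn[OF S, of UNIV 0 a] by (simp add: emeasure_density emeasure_UNIV_eq_1)
qed

end

text \<open>The set where the two functions agree is closed and has full measure.\<close>
lemma continuous_AE_eq:
  fixes f g :: "'a::euclidean_space \<Rightarrow> real"
  assumes f: "continuous_on UNIV f" and g: "continuous_on UNIV g" and ae: "AE x in lborel. f x = g x"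
  shows "f = g"
proof
  fix x
  have "x \<in> {x. f x = g x}"
    using closed_Collect_eq[OF f g] ae by (intro mem_closed_if_AE_lebesgue) (auto intro: AE_completion)
  then show "f x = g x" by simp
qed

text \<open>The law of \<open>X\<close> determines its density almost everywhere, and continuity determines it everywhere.\<close>
lemma mean_mixture_normal_density_unique:
  fixes p :: "real^'d \<Rightarrow> real"
  assumes mix: "mean_mixture_normal M V X \<theta> a S L" and p: "continuous_density M X p"
  shows "p = (\<lambda>z. mixture_density (distr M borel V) a S (z - \<theta>))"
proof -
  have S: "pos_def S" and [measurable]: "V \<in> borel_measurable M" "X \<in> borel_measurable M"
    using mix by (auto simp: mean_mixture_normal_def)
  have law: "\<forall>A\<in>sets borel. \<forall>B\<in>sets borel. emeasure M {\<omega> \<in> space M. V \<omega> \<in> A \<and> X \<omega> \<in> B} =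
    (\<integral>\<^sup>+v\<in>A. emeasure (mvn (\<theta> + v *\<^sub>R a) S) B \<partial>distr M borel V)"
    using mix by (simp add: mean_mixture_normal_def)
  interpret prob_space M
    using mix by (simp add: mean_mixture_normal_def)
  interpret D: real_distribution "distr M borel V"
    by simp
  have contp: "continuous_on UNIV p" and p0: "\<And>z. 0 \<le> p z" and dist: "distributed M lborel X (\<lambda>z. ennreal (p z))"
    using p by (auto simp: continuous_density_def)
  have [measurable]: "p \<in> borel_measurable borel"
    using contp by (rule borel_measurable_continuous_onI)
  let ?f = "\<lambda>z. mixture_density (distr M borel V) a S (z - \<theta>)"
  have "density lborel (\<lambda>z. ennreal (p z)) = density lborel (\<lambda>z. ennreal (?f z))"
  proof (rule measure_eqI)
    fix B assume "B \<in> sets (density lborel (\<lambda>z. ennreal (p z)))"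
    then have [measurable]: "B \<in> sets borel" by simp
    have "emeasure (density lborel (\<lambda>z. ennreal (p z))) B = emeasure M {\<omega> \<in> space M. V \<omega> \<in> UNIV \<and> X \<omega> \<in> B}"
      using distributed_distr_eq_density[OF dist, symmetric]
      by (simp add: emeasure_distr vimage_def Int_def conj_commute)
    also have "\<dots> = (\<integral>\<^sup>+v\<in>UNIV. emeasure (mvn (\<theta> + v *\<^sub>R a) S) B \<partial>distr M borel V)"
      using law[rule_format, of UNIV B] by simp
    finally show "emeasure (density lborel (\<lambda>z. ennreal (p z))) B = emeasure (density lborel (\<lambda>z. ennreal (?f z))) B"
      using D.nn_integral_emeasure_mvn[OF S, of B \<theta> a] by simp
  qed simp
  then have "AE z in lborel. ennreal (p z) = ennreal (?f z)"
    by (intro sigma_finite_measure.density_unique[OF sigma_finite_lborel]) simp_all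
  then have "AE z in lborel. p z = ?f z"
    using p0 D.mixture_density_pos[OF S] by (simp add: less_imp_le)
  moreover have "continuous_on UNIV ?f"
    by (intro continuous_on_compose2[OF D.continuous_on_mixture_density[OF S]] continuous_intros) simp
  ultimately show ?thesis
    using contp by (intro continuous_AE_eq)
qed

text \<open>The witness \<open>J\<close> is the joint law of the mixing variable and the observation; it has density
\<open>mvn_density (x + v a) S y\<close> with respect to the product of \<open>\<mu>\<close> and Lebesgue measure.\<close>
lemma MMN_law_mixture_density:
  fixes a x :: "real^'d"
  assumes "real_distribution \<mu>" and S: "pos_def S"
  shows "MMN_law (density lborel (\<lambda>y. ennreal (mixture_density \<mu> a S (y - x)))) x a S (cdf \<mu>)"
proof -
  interpret real_distribution \<mu> by fact
  interpret L: pair_sigma_finite \<mu> "lborel :: (real^'d) measure"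
    by (rule pair_sigma_finite_lborel)
  define J where "J = density (\<mu> \<Otimes>\<^sub>M lborel) (\<lambda>(v, y). ennreal (mvn_density (x + v *\<^sub>R a) S y))"
  have sJ [measurable_cong]: "sets J = sets (borel \<Otimes>\<^sub>M borel)"
    unfolding J_def sets_density by (intro sets_pair_measure_cong) simp_all
  have spJ: "space J = UNIV"
    by (simp add: J_def space_pair_measure)
  have J: "emeasure J (A \<times> B) = (\<integral>\<^sup>+v\<in>A. emeasure (mvn (x + v *\<^sub>R a) S) B \<partial>\<mu>)"
    if [measurable]: "A \<in> sets borel" "B \<in> sets borel" for A B
  proof -
    have "emeasure J (A \<times> B) = (\<integral>\<^sup>+z. (case z of (v, y) \<Rightarrow> ennreal (mvn_density (x + v *\<^sub>R a) S y)) * indicator (A \<times> B) z \<partial>(\<mu> \<Otimes>\<^sub>M lborel))"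
      unfolding J_def by (rule emeasure_density) measurable
    also have "\<dots> = (\<integral>\<^sup>+v. (\<integral>\<^sup>+y. ennreal (mvn_density (x + v *\<^sub>R a) S y) * indicator (A \<times> B) (v, y) \<partial>lborel) \<partial>\<mu>)"
      by (subst lborel.nn_integral_fst[symmetric]) simp_all
    also have "\<dots> = (\<integral>\<^sup>+v\<in>A. emeasure (mvn (x + v *\<^sub>R a) S) B \<partial>\<mu>)"
      by (intro nn_integral_cong) (simp add: emeasure_mvn indicator_times nn_integral_cmult[symmetric] mult_ac)
    finally show ?thesis .
  qed
  have one: "emeasure (mvn (x + v *\<^sub>R a) S) UNIV = 1" for v
    by (simp add: emeasure_mvn nn_integral_mvn_density[OF S])
  have fst: "distr J borel fst = \<mu>"
  proof (rule measure_eqI)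
    fix A assume "A \<in> sets (distr J borel fst)"
    then have A [measurable]: "A \<in> sets borel" by simp
    have "emeasure (distr J borel fst) A = emeasure J (A \<times> UNIV)"
      by (subst emeasure_distr) (auto simp: spJ intro!: arg_cong[of _ _ "emeasure J"])
    then show "emeasure (distr J borel fst) A = emeasure \<mu> A"
      by (simp add: J one)
  qed simp
  have snd: "distr J borel snd = density lborel (\<lambda>y. ennreal (mixture_density \<mu> a S (y - x)))"
  proof (rule measure_eqI)
    fix B assume "B \<in> sets (distr J borel snd)"
    then have B [measurable]: "B \<in> sets borel" by simp
    have "emeasure (distr J borel snd) B = emeasure J (UNIV \<times> B)"
      by (subst emeasure_distr) (auto simp: spJ intro!: arg_cong[of _ _ "emeasure J"])
    then show "emeasure (distr J borel snd) B = emeasure (density lborel (\<lambda>y. ennreal (mixture_density \<mu> a S (y - x)))) B"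
      using nn_integral_emeasure_mvn[OF S B, of x a] by (simp add: J)
  qed simp
  have "prob_space J"
    by (rule prob_spaceI) (use J[of UNIV UNIV] in \<open>simp add: spJ one emeasure_UNIV_eq_1\<close>)
  moreover have "{\<omega> \<in> space J. fst \<omega> \<in> A \<and> snd \<omega> \<in> B} = A \<times> B" for A B
    by (auto simp: spJ)
  ultimately have "mean_mixture_normal J fst snd x a S (cdf \<mu>)"
    unfolding mean_mixture_normal_def fst by (auto simp: S J)
  with snd show ?thesis
    unfolding MMN_law_def by blast
qed

section \<open>Prediction for mean mixtures of normal distributions\<close>

lemma location_model_mixture_density:
  assumes \<mu>: "real_distribution \<mu>" and \<nu>: "real_distribution \<nu>" and P: "pos_def P" and Q: "pos_def Q"
  shows "location_model (mixture_density \<mu> a P) (mixture_density \<nu> a Q) (mvn_density 0 P 0) (mvn_density 0 Q 0)"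
proof -
  interpret M: real_distribution \<mu> by fact
  interpret N: real_distribution \<nu> by fact
  show ?thesis
    by unfold_locales
      (simp_all add: M.mixture_density_pos N.mixture_density_pos M.mixture_density_le N.mixture_density_le P Q
        M.mass_mixture_density N.mass_mixture_density M.continuous_on_mixture_density N.continuous_on_mixture_density)
qed

text \<open>For fixed values of the mixing variables the integral over \<open>u\<close> is the convolution of two normal densities,
whose mean depends on the mixing variables only through \<open>v\<^sub>2 - v\<^sub>1\<close>.\<close>
lemma diff_density_mixture_density:
  fixes a :: "real^'d"
  assumes \<mu>: "real_distribution \<mu>" and \<nu>: "real_distribution \<nu>" and P: "pos_def P" and Q: "pos_def Q"
  shows "location_model.diff_density (mixture_density \<mu> a P) (mixture_density \<nu> a Q) w
    = mixture_density (distr (\<mu> \<Otimes>\<^sub>M \<nu>) borel (\<lambda>(v\<^sub>1, v\<^sub>2). v\<^sub>2 - v\<^sub>1)) a (P + Q) w"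
proof -
  interpret M: real_distribution \<mu> by fact
  interpret N: real_distribution \<nu> by fact
  interpret MN: pair_prob_space \<mu> \<nu>
    by unfold_locales
  interpret MxL: pair_sigma_finite \<mu> "lborel :: (real^'d) measure" by (rule M.pair_sigma_finite_lborel)
  interpret NxL: pair_sigma_finite \<nu> "lborel :: (real^'d) measure" by (rule N.pair_sigma_finite_lborel)
  interpret L: location_model "mixture_density \<mu> a P" "mixture_density \<nu> a Q" "mvn_density 0 P 0" "mvn_density 0 Q 0"
    by (rule location_model_mixture_density[OF assms])
  have [measurable_cong]: "sets (\<mu> \<Otimes>\<^sub>M \<nu>) = sets (borel \<Otimes>\<^sub>M borel)"
    by (intro sets_pair_measure_cong) simp_all
  let ?D = "distr (\<mu> \<Otimes>\<^sub>M \<nu>) borel (\<lambda>(v\<^sub>1, v\<^sub>2). v\<^sub>2 - v\<^sub>1)"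
  interpret D: real_distribution ?D
    by (intro MN.real_distribution_distr) measurable
  let ?p = "\<lambda>v u. ennreal (mvn_density (v *\<^sub>R a) P u)" and ?q = "\<lambda>v u. ennreal (mvn_density (v *\<^sub>R a) Q (w + u))"
  have "ennreal (L.diff_density w) = (\<integral>\<^sup>+u. (\<integral>\<^sup>+v\<^sub>2. ?q v\<^sub>2 u \<partial>\<nu>) * (\<integral>\<^sup>+v\<^sub>1. ?p v\<^sub>1 u \<partial>\<mu>) \<partial>lborel)"
    by (simp add: L.ennreal_diff_density M.ennreal_mixture_density[OF P] N.ennreal_mixture_density[OF Q])
  also have "\<dots> = (\<integral>\<^sup>+u. (\<integral>\<^sup>+v\<^sub>1. (\<integral>\<^sup>+v\<^sub>2. ?q v\<^sub>2 u * ?p v\<^sub>1 u \<partial>\<nu>) \<partial>\<mu>) \<partial>lborel)"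
    by (simp add: nn_integral_cmult nn_integral_multc)
  also have "\<dots> = (\<integral>\<^sup>+v\<^sub>1. (\<integral>\<^sup>+u. (\<integral>\<^sup>+v\<^sub>2. ?q v\<^sub>2 u * ?p v\<^sub>1 u \<partial>\<nu>) \<partial>lborel) \<partial>\<mu>)"
    by (rule MxL.Fubini') measurable
  also have "\<dots> = (\<integral>\<^sup>+v\<^sub>1. (\<integral>\<^sup>+v\<^sub>2. (\<integral>\<^sup>+u. ?q v\<^sub>2 u * ?p v\<^sub>1 u \<partial>lborel) \<partial>\<nu>) \<partial>\<mu>)"
    by (rule nn_integral_cong, rule NxL.Fubini') measurable
  also have "\<dots> = (\<integral>\<^sup>+v\<^sub>1. (\<integral>\<^sup>+v\<^sub>2. ennreal (mvn_density ((v\<^sub>2 - v\<^sub>1) *\<^sub>R a) (P + Q) w) \<partial>\<nu>) \<partial>\<mu>)"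
    by (simp add: mvn_density_convolution[OF P Q] scaleR_diff_left)
  also have "\<dots> = (\<integral>\<^sup>+z. ennreal (mvn_density ((case z of (v\<^sub>1, v\<^sub>2) \<Rightarrow> v\<^sub>2 - v\<^sub>1) *\<^sub>R a) (P + Q) w) \<partial>(\<mu> \<Otimes>\<^sub>M \<nu>))"
    by (subst N.nn_integral_fst[symmetric]) simp_all
  also have "\<dots> = ennreal (mixture_density ?D a (P + Q) w)"
    by (subst D.ennreal_mixture_density[OF pos_def_add[OF P Q]], subst nn_integral_distr) simp_all
  finally show ?thesis
    using L.diff_density_pos[of w] D.mixture_density_pos[OF pos_def_add[OF P Q], of a w]
    by (simp add: less_imp_le)
qed

theorem lemma3:
  fixes a :: "real^'d" and S\<^sub>X S\<^sub>Y :: "real^'d^'d" and L\<^sub>1 L\<^sub>2 L\<^sub>3 :: "real \<Rightarrow> real"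
    and M :: "real^'d \<Rightarrow> 'w measure"
    and X Y :: "'w \<Rightarrow> real^'d" and V\<^sub>1 V\<^sub>2 :: "'w \<Rightarrow> real"
    and p q :: "real^'d \<Rightarrow> real^'d \<Rightarrow> real"
  assumes "a \<noteq> 0" and "pos_def S\<^sub>X" and "pos_def S\<^sub>Y"
    and "\<And>\<theta>. prob_space (M \<theta>)"
    and "\<And>\<theta>. mean_mixture_normal (M \<theta>) V\<^sub>1 X \<theta> a S\<^sub>X L\<^sub>1"
    and "\<And>\<theta>. mean_mixture_normal (M \<theta>) V\<^sub>2 Y \<theta> a S\<^sub>Y L\<^sub>2"
    and "\<And>\<theta>. prob_space.indep_var (M \<theta>) borel X borel Y"
    and "\<And>\<theta>. prob_space.indep_var (M \<theta>) borel V\<^sub>1 borel V\<^sub>2"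
    and "\<And>\<theta>. L\<^sub>3 = cdf (distr (M \<theta>) borel (\<lambda>\<omega>. V\<^sub>2 \<omega> - V\<^sub>1 \<omega>))"
    and "\<And>\<theta>. continuous_density (M \<theta>) X (p \<theta>)"
    and "\<And>\<theta>. continuous_density (M \<theta>) Y (q \<theta>)"
  shows "is_MRE p q (bayes_uniform p q) \<and>
    (\<forall>x. MMN_law (density lborel (\<lambda>y. ennreal (bayes_uniform p q y x))) x a (S\<^sub>X + S\<^sub>Y) L\<^sub>3) \<and>
    is_minimax p q (bayes_uniform p q)"
proof -
  have [measurable]: "V\<^sub>1 \<in> borel_measurable (M \<theta>)" "V\<^sub>2 \<in> borel_measurable (M \<theta>)" for \<theta>
    using assms(5,6)[of \<theta>] by (auto simp: mean_mixture_normal_def)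
  \<comment> \<open>The mixing laws do not depend on \<open>\<theta>\<close>, because their cdfs do not.\<close>
  define \<mu> where "\<mu> = distr (M 0) borel V\<^sub>1"
  define \<nu> where "\<nu> = distr (M 0) borel V\<^sub>2"
  have rd: "real_distribution (distr (M \<theta>) borel V)" if "V \<in> borel_measurable (M \<theta>)" for \<theta> V
    by (rule prob_space.real_distribution_distr[OF assms(4) that])
  have \<mu>: "real_distribution \<mu>" "distr (M \<theta>) borel V\<^sub>1 = \<mu>" for \<theta>
    unfolding \<mu>_def using assms(5)[of \<theta>] assms(5)[of 0]
    by (auto intro!: rd cdf_unique simp: mean_mixture_normal_def)
  have \<nu>: "real_distribution \<nu>" "distr (M \<theta>) borel V\<^sub>2 = \<nu>" for \<theta>
    unfolding \<nu>_def using assms(6)[of \<theta>] assms(6)[of 0]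
    by (auto intro!: rd cdf_unique simp: mean_mixture_normal_def)
  interpret L: location_model "mixture_density \<mu> a S\<^sub>X" "mixture_density \<nu> a S\<^sub>Y" "mvn_density 0 S\<^sub>X 0" "mvn_density 0 S\<^sub>Y 0"
    by (rule location_model_mixture_density[OF \<mu>(1) \<nu>(1) assms(2,3)])
  have pq: "p = (\<lambda>\<theta> x. mixture_density \<mu> a S\<^sub>X (x - \<theta>))" "q = (\<lambda>\<theta> y. mixture_density \<nu> a S\<^sub>Y (y - \<theta>))"
    using mean_mixture_normal_density_unique[OF assms(5) assms(10)]
      mean_mixture_normal_density_unique[OF assms(6) assms(11)] by (simp_all add: \<mu>(2) \<nu>(2) fun_eq_iff)
  let ?D = "distr (M 0) borel (\<lambda>\<omega>. V\<^sub>2 \<omega> - V\<^sub>1 \<omega>)"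
  have "\<mu> \<Otimes>\<^sub>M \<nu> = distr (M 0) (borel \<Otimes>\<^sub>M borel) (\<lambda>\<omega>. (V\<^sub>1 \<omega>, V\<^sub>2 \<omega>))"
    using assms(8)[of 0] by (simp add: prob_space.indep_var_distribution_eq[OF assms(4)] \<mu>_def \<nu>_def)
  then have "distr (\<mu> \<Otimes>\<^sub>M \<nu>) borel (\<lambda>(v\<^sub>1, v\<^sub>2). v\<^sub>2 - v\<^sub>1) = ?D"
    by (simp add: distr_distr o_def)
  then have "L.diff_density w = mixture_density ?D a (S\<^sub>X + S\<^sub>Y) w" for w
    by (simp add: diff_density_mixture_density[OF \<mu>(1) \<nu>(1) assms(2,3)])
  then have bayes: "bayes_uniform p q = (\<lambda>y x. mixture_density ?D a (S\<^sub>X + S\<^sub>Y) (y - x))"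
    "bayes_uniform p q = (\<lambda>y x. L.diff_density (y - x))"
    unfolding pq L.bayes_uniform_eq by simp_all
  have "MMN_law (density lborel (\<lambda>y. ennreal (bayes_uniform p q y x))) x a (S\<^sub>X + S\<^sub>Y) L\<^sub>3" for x
    unfolding bayes(1) assms(9)[of 0]
    by (intro MMN_law_mixture_density rd pos_def_add assms(2,3)) measurable
  moreover have "is_MRE p q (bayes_uniform p q)" "is_minimax p q (bayes_uniform p q)"
    unfolding bayes(2) unfolding pq by (rule L.is_MRE_diff_density L.is_minimax_diff_density)+
  ultimately show ?thesis
    by blast
qed


end
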